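(* For every positive integer $n$, every matrix $M \in \mathrm{GL}_{2n}(\mathbb{R})$ with $\det(M)>0$ can be represented by a depth-six linear affine coupling network. In addition, for every integer $n>1$, there exists $M \in \mathrm{SL}_{2n}(\mathbb{R})$ for which six layers are necessary, i.e., $M$ cannot be exactly represented by a depth-five linear affine coupling network.
   Context: A linear affine coupling layer (on $\mathbb{R}^{2n}$) is a $2n\times 2n$ real matrix of the form $\begin{bmatrix} I & 0 \\ A & D \end{bmatrix}$ or $\begin{bmatrix} D & A \\ 0 & I \end{bmatrix}$, where $A$ is a real $n\times n$ matrix, $D$ is an $n\times n$ real diagonal matrix with strictly positive diagonal entries, and $I$, $0$ are the $n\times n$ identity and zero matrices. A matrix is (exactly) represented by a depth-$k$ linear affine coupling network if it equals a product of $k$ linear affine coupling layers. $\mathrm{GL}_{2n}(\mathbb{R})$ and $\mathrm{SL}_{2n}(\mathbb{R})$ are the groups of real $2n\times 2n$ matrices that are invertible, respectively of determinant one. *)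

theory Defs
  imports Complex_Main "Jordan_Normal_Form.Matrix" "Jordan_Normal_Form.Determinant"
begin

definition GL :: "nat \<Rightarrow> real mat set" where
  "GL m = {M \<in> carrier_mat m m. invertible_mat M}"

definition SL :: "nat \<Rightarrow> real mat set" where
  "SL m = {M \<in> carrier_mat m m. det M = 1}"

definition pos_diagonal :: "nat \<Rightarrow> real mat \<Rightarrow> bool" where
  "pos_diagonal n D \<longleftrightarrow>
     D \<in> carrier_mat n n \<and> diagonal_mat D \<and> (\<forall>i<n. D $$ (i, i) > 0)"

definition linear_affine_coupling_layer :: "nat \<Rightarrow> real mat \<Rightarrow> bool" where
  "linear_affine_coupling_layer n L \<longleftrightarrow>
     (\<exists>A D. A \<in> carrier_mat n n \<and> pos_diagonal n D \<and>
        (L = four_block_mat (1\<^sub>m n) (0\<^sub>m n n) A D \<or>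
         L = four_block_mat D A (0\<^sub>m n n) (1\<^sub>m n)))"

(* The two layer types may occur in any order; they are not required to alternate. *)
definition represented_by_depth :: "nat \<Rightarrow> nat \<Rightarrow> real mat \<Rightarrow> bool" where
  "represented_by_depth n k M \<longleftrightarrow>
     (\<exists>Ls. length Ls = k \<and> (\<forall>L \<in> set Ls. linear_affine_coupling_layer n L) \<and>
        M = foldr (*) Ls (1\<^sub>m (2 * n)))"

end

theory Submission
  imports Defs
begin

text \<open>Write \<open>L(A)\<close> and \<open>U(A)\<close> for the layers with \<open>D = I\<close>, and \<open>X, Y, Z, W\<close> for the blocks of \<open>M\<close>.

  Lower bound. A product of five layers is an alternating one, \<open>LULUL\<close> or \<open>ULULU\<close>. Let
  \<open>M = diag(I, W)\<close> where \<open>W\<close> is a signed cyclic permutation matrix of determinant one, so that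
  \<open>W\<close> and its inverse have zero diagonal. Comparing blocks, the identity
  \<open>trace (AB) = trace (BA)\<close> equates the trace of a positive diagonal matrix with the
  trace of \<open>W E\<close> or \<open>W\<^sup>-\<^sup>1 E\<close> for a diagonal \<open>E\<close>, which is zero.

  Upper bound. Since \<open>(X, Z)\<close> has full column rank, some \<open>Z + pX\<close> is invertible, so that
  multiplication by \<open>L(p)\<close> on the left and by some \<open>U(q)\<close> on the right reduces to \<open>W = 0\<close> with \<open>Y\<close>
  and \<open>Z\<close> invertible and \<open>det M = det (- Y Z)\<close>. Choose a positive diagonal \<open>D\<close> for which
  \<open>G = - Y Z D\<close> has determinant one and is not scalar (unless \<open>n = 1\<close>). As in Sourour's
  factorization theorem there is an invertible \<open>Q\<close> similar to \<open>G Q\<close>. After replacing \<open>X, Z\<close> by \<open>X D, Z D\<close>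
  and multiplying by \<open>U(- Q Y)\<close>, the lower right block is \<open>- Z Q Y\<close>, conjugate to \<open>G Q\<close> and hence
  to \<open>Q\<close>, while its Schur complement is \<open>Q\<^sup>-\<^sup>1\<close>; such a matrix is a product \<open>ULUL\<close>. The factors \<open>U\<close> on
  the right together with \<open>diag(D\<^sup>-\<^sup>1, I)\<close> form a single layer.\<close>

section \<open>Block matrix algebra\<close>

text \<open>The library's carrier premises mention dimensions that do not occur in the conclusion; stated
  through \<open>dim_row\<close> and \<open>dim_col\<close>, the same laws become usable as conditional rewrite rules.\<close>

lemma mat_assoc_dim:
  "dim_col A = dim_row B \<Longrightarrow> dim_col B = dim_row C \<Longrightarrow> A * B * C = A * (B * C)"
  for A B C :: "'a::semiring_0 mat"
  by (rule assoc_mult_mat[of A "dim_row A" "dim_row B" B "dim_row C" C "dim_col C"]) auto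

lemma mat_add_mult_dim:
  "dim_row A = dim_row B \<Longrightarrow> dim_col A = dim_col B \<Longrightarrow> dim_col B = dim_row C \<Longrightarrow>
    (A + B) * C = A * C + B * C"
  for A B C :: "'a::semiring_0 mat"
  by (rule add_mult_distrib_mat[of A "dim_row A" "dim_row C" B C "dim_col C"]) auto

lemma mat_mult_add_dim:
  "dim_row B = dim_row C \<Longrightarrow> dim_col B = dim_col C \<Longrightarrow> dim_col A = dim_row C \<Longrightarrow>
    A * (B + C) = A * B + A * C"
  for A B C :: "'a::semiring_0 mat"
  by (rule mult_add_distrib_mat[of A "dim_row A" "dim_row C" B "dim_col C" C]) auto

lemma mat_minus_mult_dim:
  "dim_row A = dim_row B \<Longrightarrow> dim_col A = dim_col B \<Longrightarrow> dim_col B = dim_row C \<Longrightarrow>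
    (A - B) * C = A * C - B * C"
  for A B C :: "'a::ring mat"
  by (rule minus_mult_distrib_mat[of A "dim_row A" "dim_row C" B C "dim_col C"]) auto

lemma mat_mult_minus_dim:
  "dim_row B = dim_row C \<Longrightarrow> dim_col B = dim_col C \<Longrightarrow> dim_col A = dim_row C \<Longrightarrow>
    A * (B - C) = A * B - A * C"
  for A B C :: "'a::ring mat"
  by (rule mult_minus_distrib_mat[of A "dim_row A" "dim_row C" B "dim_col C" C]) auto

lemma mat_mult_one_dim:
  fixes A :: "'a::semiring_1 mat"
  shows "dim_col A = n \<Longrightarrow> A * 1\<^sub>m n = A" "dim_row A = n \<Longrightarrow> 1\<^sub>m n * A = A"
  by (rule right_mult_one_mat[of A "dim_row A" n], auto)

lemma mat_mult_zero_dim: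
  fixes A :: "'a::semiring_0 mat"
  shows "dim_col A = n \<Longrightarrow> A * 0\<^sub>m n k = 0\<^sub>m (dim_row A) k"
    "dim_row A = n \<Longrightarrow> 0\<^sub>m k n * A = 0\<^sub>m k (dim_col A)"
  by (rule right_mult_zero_mat[of A "dim_row A" n], auto)

lemma mat_add_zero_dim:
  fixes A :: "'a::monoid_add mat"
  shows "dim_row A = n \<Longrightarrow> dim_col A = k \<Longrightarrow> A + 0\<^sub>m n k = A"
    "dim_row A = n \<Longrightarrow> dim_col A = k \<Longrightarrow> 0\<^sub>m n k + A = A"
  by (rule eq_matI; simp)+

lemma mat_mult_four_block_dim:
  fixes A1 :: "'a::semiring_0 mat"
  assumes "dim_row B1 = dim_row A1" "dim_row D1 = dim_row C1" "dim_col C1 = dim_col A1"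
    "dim_col D1 = dim_col B1" "dim_row B2 = dim_row A2" "dim_row D2 = dim_row C2"
    "dim_col C2 = dim_col A2" "dim_col D2 = dim_col B2"
    "dim_col A1 = dim_row A2" "dim_col B1 = dim_row C2"
  shows "four_block_mat A1 B1 C1 D1 * four_block_mat A2 B2 C2 D2
    = four_block_mat (A1 * A2 + B1 * C2) (A1 * B2 + B1 * D2)
        (C1 * A2 + D1 * C2) (C1 * B2 + D1 * D2)"
  by (rule mult_four_block_mat[of A1 "dim_row A1" "dim_col A1" B1 "dim_col B1" C1 "dim_row C1"
        D1 A2 "dim_col A2" B2 "dim_col B2"]) (use assms in auto)

lemma mat_add_assoc_dim:
  "dim_row A = dim_row B \<Longrightarrow> dim_col A = dim_col B \<Longrightarrow> dim_row B = dim_row C \<Longrightarrow>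
    dim_col B = dim_col C \<Longrightarrow> A + B + C = A + (B + C)"
  for A B C :: "'a::semigroup_add mat"
  by (rule eq_matI) (simp_all add: add.assoc)

lemma mat_uminus_dim:
  fixes A :: "'a::group_add mat"
  shows "- A + A = 0\<^sub>m (dim_row A) (dim_col A)" "A + - A = 0\<^sub>m (dim_row A) (dim_col A)"
    "- (0\<^sub>m n m :: 'a mat) = 0\<^sub>m n m"
  by (rule eq_matI; simp)+

text \<open>A normal form for noncommutative expressions: products are expanded, sums and products
  associate to the right. Commutativity of addition is left out, which accounts for the order of
  summands in later definitions.\<close>

lemmas mat_dim_simps =
  mat_add_assoc_dim mat_uminus_dim
  mat_assoc_dim mat_add_mult_dim mat_mult_add_dim mat_minus_mult_dim mat_mult_minus_dim
  mat_mult_one_dim mat_mult_zero_dim mat_add_zero_dim mat_mult_four_block_dim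

text \<open>The carrier premises fix where the blocks meet. Sizes may be zero, so columns split into
  an upper and a lower part, with blocks of width zero beside them, can be compared too.\<close>

lemma four_block_mat_inject:
  assumes eq: "four_block_mat A B C D = four_block_mat A' B' C' D'"
    and dims: "A \<in> carrier_mat n k" "A' \<in> carrier_mat n k"
    "B \<in> carrier_mat n l" "B' \<in> carrier_mat n l"
    "C \<in> carrier_mat m k" "C' \<in> carrier_mat m k"
    "D \<in> carrier_mat m l" "D' \<in> carrier_mat m l"
  shows "A = A'" "B = B'" "C = C'" "D = D'"
proof -
  have e: "four_block_mat A B C D $$ (i,j) = four_block_mat A' B' C' D' $$ (i,j)" for i j
    using eq by simp
  show "A = A'"
  proof (rule eq_matI)
    fix i j assume "i < dim_row A'" "j < dim_col A'"
    then show "A $$ (i,j) = A' $$ (i,j)" using e[of i j] dims by auto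
  qed (use dims in auto)
  show "B = B'"
  proof (rule eq_matI)
    fix i j assume "i < dim_row B'" "j < dim_col B'"
    then show "B $$ (i,j) = B' $$ (i,j)" using e[of i "k + j"] dims by auto
  qed (use dims in auto)
  show "C = C'"
  proof (rule eq_matI)
    fix i j assume "i < dim_row C'" "j < dim_col C'"
    then show "C $$ (i,j) = C' $$ (i,j)" using e[of "n + i" j] dims by auto
  qed (use dims in auto)
  show "D = D'"
  proof (rule eq_matI)
    fix i j assume "i < dim_row D'" "j < dim_col D'"
    then show "D $$ (i,j) = D' $$ (i,j)" using e[of "n + i" "k + j"] dims by auto
  qed (use dims in auto)
qed

section \<open>Five layers do not suffice\<close>

definition mat_trace :: "real mat \<Rightarrow> real" where
  "mat_trace A = (\<Sum>i<dim_row A. A $$ (i, i))"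

lemma mat_trace_mult_commute:
  assumes "A \<in> carrier_mat n m" "B \<in> carrier_mat m n"
  shows "mat_trace (A * B) = mat_trace (B * A)"
proof -
  have "mat_trace (A * B) = (\<Sum>i<n. \<Sum>j<m. A $$ (i,j) * B $$ (j,i))"
    using assms by (auto simp: mat_trace_def scalar_prod_def lessThan_atLeast0 intro!: sum.cong)
  also have "\<dots> = (\<Sum>j<m. \<Sum>i<n. B $$ (j,i) * A $$ (i,j))"
    by (subst sum.swap) (simp add: mult.commute)
  also have "\<dots> = mat_trace (B * A)"
    using assms by (auto simp: mat_trace_def scalar_prod_def lessThan_atLeast0 intro!: sum.cong)
  finally show ?thesis .
qed

lemma mat_trace_one [simp]: "mat_trace (1\<^sub>m n) = real n"
  by (simp add: mat_trace_def)

lemma mat_trace_minus: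
  "A \<in> carrier_mat n n \<Longrightarrow> B \<in> carrier_mat n n \<Longrightarrow> mat_trace (A - B) = mat_trace A - mat_trace B"
  by (auto simp: mat_trace_def sum_subtractf)

lemma index_mult_pos_diagonal:
  assumes "pos_diagonal n D" "A \<in> carrier_mat m n" "i < m" "j < n"
  shows "(A * D) $$ (i, j) = A $$ (i, j) * D $$ (j, j)"
proof -
  have "(A * D) $$ (i, j) = (\<Sum>k<n. A $$ (i,k) * D $$ (k,j))"
    using assms by (auto simp: pos_diagonal_def scalar_prod_def lessThan_atLeast0 intro!: sum.cong)
  also have "\<dots> = (\<Sum>k<n. if k = j then A $$ (i,j) * D $$ (j,j) else 0)"
    using assms by (intro sum.cong) (auto simp: pos_diagonal_def diagonal_mat_def)
  finally show ?thesis using assms by simp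
qed

lemma pos_diagonal_carrier: "pos_diagonal n D \<Longrightarrow> D \<in> carrier_mat n n"
  by (simp add: pos_diagonal_def)

lemma pos_diagonal_one: "pos_diagonal n (1\<^sub>m n)"
  by (auto simp: pos_diagonal_def diagonal_mat_def)

lemma pos_diagonal_mult:
  assumes "pos_diagonal n D" "pos_diagonal n E"
  shows "pos_diagonal n (D * E)"
  using assms index_mult_pos_diagonal[OF assms(2), of D n]
  by (auto simp: pos_diagonal_def diagonal_mat_def)

lemma pos_diagonal_inverse:
  assumes "pos_diagonal n D"
  obtains E where "pos_diagonal n E" "D * E = 1\<^sub>m n" "E * D = 1\<^sub>m n"
proof -
  define E where "E = mat n n (\<lambda>(i,j). if i = j then 1 / D $$ (i,i) else 0)"
  have E: "pos_diagonal n E"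
    using assms by (auto simp: E_def pos_diagonal_def diagonal_mat_def)
  have "D * E = 1\<^sub>m n" "E * D = 1\<^sub>m n"
    using assms index_mult_pos_diagonal[OF E, of D n] index_mult_pos_diagonal[OF assms, of E n]
    by (auto intro!: eq_matI simp: pos_diagonal_def diagonal_mat_def E_def order_less_imp_not_eq2)
  with E show thesis by (rule that)
qed

lemma mat_trace_pos_diagonal:
  assumes "pos_diagonal n D" "n > 0"
  shows "mat_trace D > 0"
  using assms unfolding mat_trace_def pos_diagonal_def by (intro sum_pos) auto

lemma mat_trace_mult_pos_diagonal_zero:
  assumes "pos_diagonal n D" "W \<in> carrier_mat n n" "\<And>i. i < n \<Longrightarrow> W $$ (i, i) = 0"
  shows "mat_trace (W * D) = 0"
  using assms index_mult_pos_diagonal[OF assms(1,2)] by (simp add: mat_trace_def)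

text \<open>For \<open>n > 1\<close> the cyclic shift has no fixed point. Its matrix stays
  orthogonal after a sign change in row 0, so the inverse is the transpose and has zero diagonal as
  well.\<close>

lemma exists_hollow_inverse_pair:
  assumes "n > 1"
  obtains W W' :: "real mat"
  where "W \<in> carrier_mat n n" "W' \<in> carrier_mat n n" "W * W' = 1\<^sub>m n" "W' * W = 1\<^sub>m n" "det W = 1"
    "\<And>i. i < n \<Longrightarrow> W $$ (i, i) = 0" "\<And>i. i < n \<Longrightarrow> W' $$ (i, i) = 0"
proof -
  define P :: "real \<Rightarrow> real mat" where
    "P s = mat n n (\<lambda>(i,j). if j = (i + 1) mod n then (if i = 0 then s else 1) else 0)" for s
  have Pc [simp]: "P s \<in> carrier_mat n n" for s by (simp add: P_def)
  have ne: "i \<noteq> Suc i mod n" if "i < n" for i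
    using that assms by (metis One_nat_def Suc_lessI mod_less mod_self n_not_Suc_n less_irrefl)
  have inj: "i = k" if "Suc i mod n = Suc k mod n" "i < n" "k < n" for i k
    using that by (metis Suc_lessI mod_less mod_self nat.inject nat.distinct(1))
  have PPt: "P s * transpose_mat (P s) = 1\<^sub>m n" if "s * s = 1" for s
  proof (rule eq_matI)
    fix i k assume "i < dim_row (1\<^sub>m n :: real mat)" "k < dim_col (1\<^sub>m n :: real mat)"
    then have ik: "i < n" "k < n" by auto
    have "(P s * transpose_mat (P s)) $$ (i,k) = (\<Sum>j<n. P s $$ (i,j) * P s $$ (k,j))"
      using ik by (simp add: P_def scalar_prod_def lessThan_atLeast0)
    also have "\<dots> = (\<Sum>j<n. if j = Suc i mod n then (if i = k then 1 else 0) else 0)"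
      using ik inj[of i k] that by (intro sum.cong) (auto simp: P_def)
    also have "\<dots> = (1\<^sub>m n) $$ (i,k)" using ik by simp
    finally show "(P s * transpose_mat (P s)) $$ (i,k) = (1\<^sub>m n) $$ (i,k)" .
  qed (simp_all add: P_def)
  have "det (P 1) * det (P 1) = det (P 1 * transpose_mat (P 1))"
    by (subst det_mult[of _ n]) (auto simp: det_transpose[of _ n])
  then have d1: "det (P 1) * det (P 1) = 1" by (simp add: PPt)
  have mr: "P s = multrow 0 s (P 1)" for s
    using assms by (intro eq_matI) (auto simp: P_def)
  have ds: "det (P s) = s * det (P 1)" for s
    by (subst mr, rule det_multrow[of 0 n]) (use assms in auto)
  \<comment> \<open>This is 1 or -1 by orthogonality, so scaling row 0 by it gives determinant
    \<open>s * s = 1\<close>; the parity of the cycle need not be computed.\<close>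
  define s where "s = det (P 1)"
  have ss: "s * s = 1" using d1 by (simp add: s_def)
  show thesis
  proof (rule that[of "P s" "transpose_mat (P s)"])
    show "P s * transpose_mat (P s) = 1\<^sub>m n" using PPt[OF ss] .
    then show "transpose_mat (P s) * P s = 1\<^sub>m n"
      by (rule mat_mult_left_right_inverse[rotated 2]) auto
    show "det (P s) = 1" using ds[of s] ss by (simp add: s_def)
    show "P s $$ (i, i) = 0" "transpose_mat (P s) $$ (i, i) = 0" if "i < n" for i
      using that ne[OF that] by (auto simp: P_def)
  qed auto
qed

section \<open>Alternating products of layers\<close>

definition coupling_layers :: "bool \<Rightarrow> nat \<Rightarrow> real mat set" where
  "coupling_layers lower n = {L. \<exists>A D. A \<in> carrier_mat n n \<and> pos_diagonal n D \<and>
     L = (if lower then four_block_mat (1\<^sub>m n) (0\<^sub>m n n) A D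
          else four_block_mat D A (0\<^sub>m n n) (1\<^sub>m n))}"

text \<open>With the shape as a Boolean flag, alternation is negation, and one argument covers both
  starting shapes.\<close>

primrec alternating_products :: "bool \<Rightarrow> nat \<Rightarrow> nat \<Rightarrow> real mat set" where
  "alternating_products lower n 0 = {1\<^sub>m (2 * n)}"
| "alternating_products lower n (Suc k) =
     {L * N | L N. L \<in> coupling_layers lower n \<and> N \<in> alternating_products (\<not> lower) n k}"

lemma coupling_layers_carrier: "L \<in> coupling_layers b n \<Longrightarrow> L \<in> carrier_mat (2 * n) (2 * n)"
  by (auto simp: coupling_layers_def pos_diagonal_def mult_2 split: if_splits)

lemma alternating_products_carrier:
  "N \<in> alternating_products b n k \<Longrightarrow> N \<in> carrier_mat (2 * n) (2 * n)"
  by (induction k arbitrary: b N) (auto dest!: coupling_layers_carrier)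

lemma one_mem_coupling_layers: "1\<^sub>m (2 * n) \<in> coupling_layers b n"
  unfolding coupling_layers_def mult_2
  by (rule CollectI, rule exI[of _ "0\<^sub>m n n"], rule exI[of _ "1\<^sub>m n"]) (simp add: pos_diagonal_one)

lemma coupling_layers_mult:
  assumes "K \<in> coupling_layers b n" "L \<in> coupling_layers b n"
  shows "K * L \<in> coupling_layers b n"
proof -
  obtain A D where A: "A \<in> carrier_mat n n" "pos_diagonal n D"
     "K = (if b then four_block_mat (1\<^sub>m n) (0\<^sub>m n n) A D
          else four_block_mat D A (0\<^sub>m n n) (1\<^sub>m n))"
    using assms by (auto simp: coupling_layers_def)
  obtain B E where B: "B \<in> carrier_mat n n" "pos_diagonal n E"
     "L = (if b then four_block_mat (1\<^sub>m n) (0\<^sub>m n n) B E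
          else four_block_mat E B (0\<^sub>m n n) (1\<^sub>m n))"
    using assms by (auto simp: coupling_layers_def)
  have [simp]: "dim_row A = n" "dim_col A = n" "dim_row B = n" "dim_col B = n" "dim_row D = n"
    "dim_col D = n" "dim_row E = n" "dim_col E = n"
    using A B pos_diagonal_carrier by auto
  have "K * L = (if b then four_block_mat (1\<^sub>m n) (0\<^sub>m n n) (A + D * B) (D * E)
          else four_block_mat (D * E) (D * B + A) (0\<^sub>m n n) (1\<^sub>m n))"
    unfolding A B by (simp add: mat_dim_simps)
  moreover have "A + D * B \<in> carrier_mat n n" "D * B + A \<in> carrier_mat n n"
    by (auto intro!: carrier_matI)
  ultimately show ?thesis
    using pos_diagonal_mult[OF A(2) B(2)] by (auto simp: coupling_layers_def)
qed

text \<open>The identity is a layer of either shape, so a factor can be appended at the right end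
  without changing the first shape.\<close>

lemma alternating_products_Suc_mono:
  "N \<in> alternating_products b n k \<Longrightarrow> N \<in> alternating_products b n (Suc k)"
proof (induction k arbitrary: b N)
  case 0
  then have "N = 1\<^sub>m (2 * n) * 1\<^sub>m (2 * n)" by simp
  moreover have "1\<^sub>m (2 * n) \<in> alternating_products (\<not> b) n 0" by simp
  ultimately show ?case
    using one_mem_coupling_layers[of n b] unfolding alternating_products.simps(2) by blast
next
  case (Suc k)
  from Suc.prems obtain L P where "N = L * P" "L \<in> coupling_layers b n"
    "P \<in> alternating_products (\<not> b) n k" by auto
  moreover from this(3) have "P \<in> alternating_products (\<not> b) n (Suc k)" by (rule Suc.IH)
  ultimately show ?case
    unfolding alternating_products.simps(2)[of b n "Suc k"] mem_Collect_eq by (intro exI conjI)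
qed

text \<open>Two adjacent layers of one shape merge into one; the length lost is restored by padding
  with the identity.\<close>

lemma coupling_layer_mult_alternating_same:
  assumes "L \<in> coupling_layers b n" "N \<in> alternating_products b n k"
  shows "L * N \<in> alternating_products b n (Suc k)"
proof (cases k)
  case 0
  then show ?thesis using assms by auto
next
  case (Suc j)
  then obtain K P where KP: "N = K * P" "K \<in> coupling_layers b n"
    "P \<in> alternating_products (\<not> b) n j" using assms by auto
  have "L * N = (L * K) * P"
    using coupling_layers_carrier[OF assms(1)] coupling_layers_carrier[OF KP(2)]
      alternating_products_carrier[OF KP(3)] KP(1) by (simp add: mat_assoc_dim)
  then have "L * N \<in> alternating_products b n k"
    using coupling_layers_mult[OF assms(1) KP(2)] KP(3) Suc by auto
  then show ?thesis by (rule alternating_products_Suc_mono)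
qed

text \<open>Induction over the list: a new layer either continues the alternation or is absorbed
  into the first factor, so the two alternating patterns account for all orders.\<close>

lemma represented_by_depth_imp_alternating:
  assumes "represented_by_depth n k M"
  shows "\<exists>b. M \<in> alternating_products b n k"
proof -
  have "\<exists>b. foldr (*) Ls (1\<^sub>m (2 * n)) \<in> alternating_products b n (length Ls)"
    if "\<forall>L \<in> set Ls. linear_affine_coupling_layer n L" for Ls
    using that
  proof (induction Ls)
    case (Cons L Ls)
    from Cons obtain b where N: "foldr (*) Ls (1\<^sub>m (2 * n)) \<in> alternating_products b n (length Ls)"
      by auto
    from Cons.prems have "L \<in> coupling_layers True n \<or> L \<in> coupling_layers False n"
      by (auto simp: linear_affine_coupling_layer_def coupling_layers_def)
    then obtain c where L: "L \<in> coupling_layers c n" by blast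
    show ?case
    proof (cases "c = b")
      case True
      then show ?thesis using coupling_layer_mult_alternating_same[OF L, of _ "length Ls"] N
        by (intro exI[of _ b]) (simp del: alternating_products.simps)
    next
      case False
      then have "b = (\<not> c)" by auto
      then have "L * foldr (*) Ls (1\<^sub>m (2 * n)) \<in> alternating_products c n (Suc (length Ls))"
        using L N unfolding alternating_products.simps by blast
      then show ?thesis by auto
    qed
  qed auto
  then show ?thesis using assms unfolding represented_by_depth_def by blast
qed

text \<open>The outer layers have the same shape, so a zero block of the matrix forces the product
  of the three inner ones to be block triangular. This determines \<open>A4\<close> and leaves one
  equation involving \<open>A3 * (D4 * A2)\<close> or \<open>A3 * (D4 * (W' * A2))\<close>, whose
  trace can be computed from \<open>A2 * A3\<close>.\<close>

lemma four_block_one_hollow_not_alternating: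
  assumes n: "n > 1" and W: "W \<in> carrier_mat n n" "W' \<in> carrier_mat n n" "W' * W = 1\<^sub>m n"
    and W0: "\<And>i. i < n \<Longrightarrow> W $$ (i, i) = 0" and W'0: "\<And>i. i < n \<Longrightarrow> W' $$ (i, i) = 0"
  shows "four_block_mat (1\<^sub>m n) (0\<^sub>m n n) (0\<^sub>m n n) W \<notin> alternating_products b n 5"
proof
  let ?M = "four_block_mat (1\<^sub>m n) (0\<^sub>m n n) (0\<^sub>m n n) W"
  assume "?M \<in> alternating_products b n 5"
  then obtain L1 L2 L3 L4 L5 where L:
    "?M = L1 * (L2 * (L3 * (L4 * (L5 * 1\<^sub>m (2 * n)))))"
    "L1 \<in> coupling_layers b n" "L2 \<in> coupling_layers (\<not> b) n" "L3 \<in> coupling_layers b n"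
    "L4 \<in> coupling_layers (\<not> b) n" "L5 \<in> coupling_layers b n"
    by (auto simp: numeral_eq_Suc)
  have M: "?M = L1 * ((L2 * (L3 * L4)) * L5)"
    using L(1) L(2-6)[THEN coupling_layers_carrier] by (simp add: mat_dim_simps)
  obtain A1 D1 where 1: "A1 \<in> carrier_mat n n" "pos_diagonal n D1"
    "L1 = (if b then four_block_mat (1\<^sub>m n) (0\<^sub>m n n) A1 D1
      else four_block_mat D1 A1 (0\<^sub>m n n) (1\<^sub>m n))"
    using L(2) by (auto simp: coupling_layers_def)
  obtain A2 D2 where 2: "A2 \<in> carrier_mat n n" "pos_diagonal n D2"
    "L2 = (if \<not> b then four_block_mat (1\<^sub>m n) (0\<^sub>m n n) A2 D2
      else four_block_mat D2 A2 (0\<^sub>m n n) (1\<^sub>m n))"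
    using L(3) by (auto simp: coupling_layers_def)
  obtain A3 D3 where 3: "A3 \<in> carrier_mat n n" "pos_diagonal n D3"
    "L3 = (if b then four_block_mat (1\<^sub>m n) (0\<^sub>m n n) A3 D3
      else four_block_mat D3 A3 (0\<^sub>m n n) (1\<^sub>m n))"
    using L(4) by (auto simp: coupling_layers_def)
  obtain A4 D4 where 4: "A4 \<in> carrier_mat n n" "pos_diagonal n D4"
    "L4 = (if \<not> b then four_block_mat (1\<^sub>m n) (0\<^sub>m n n) A4 D4
      else four_block_mat D4 A4 (0\<^sub>m n n) (1\<^sub>m n))"
    using L(5) by (auto simp: coupling_layers_def)
  obtain A5 D5 where 5: "A5 \<in> carrier_mat n n" "pos_diagonal n D5"
    "L5 = (if b then four_block_mat (1\<^sub>m n) (0\<^sub>m n n) A5 D5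
      else four_block_mat D5 A5 (0\<^sub>m n n) (1\<^sub>m n))"
    using L(6) by (auto simp: coupling_layers_def)
  obtain E1 where E1: "pos_diagonal n E1" "D1 * E1 = 1\<^sub>m n" "E1 * D1 = 1\<^sub>m n"
    using pos_diagonal_inverse[OF 1(2)] .
  obtain E3 where E3: "pos_diagonal n E3" "D3 * E3 = 1\<^sub>m n" "E3 * D3 = 1\<^sub>m n"
    using pos_diagonal_inverse[OF 3(2)] .
  obtain E4 where E4: "pos_diagonal n E4" "D4 * E4 = 1\<^sub>m n" "E4 * D4 = 1\<^sub>m n"
    using pos_diagonal_inverse[OF 4(2)] .
  obtain E5 where E5: "pos_diagonal n E5" "D5 * E5 = 1\<^sub>m n" "E5 * D5 = 1\<^sub>m n"
    using pos_diagonal_inverse[OF 5(2)] .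
  note carr [simp] = W(1,2) 1(1) 2(1) 3(1) 4(1) 5(1) 1(2)[THEN pos_diagonal_carrier]
    2(2)[THEN pos_diagonal_carrier] 3(2)[THEN pos_diagonal_carrier] 4(2)[THEN pos_diagonal_carrier]
    5(2)[THEN pos_diagonal_carrier] E1(1)[THEN pos_diagonal_carrier]
    E3(1)[THEN pos_diagonal_carrier] E4(1)[THEN pos_diagonal_carrier] E5(1)[THEN pos_diagonal_carrier]
  note [simp] = carr[THEN carrier_matD(1)] carr[THEN carrier_matD(2)]
  have cancel: "X * (Y * Z) = Z" if "X * Y = 1\<^sub>m n" "dim_row Z = n" "dim_col X = dim_row Y" "dim_col Y = n"
    for X Y Z :: "real mat"
    using that by (simp add: mat_assoc_dim[symmetric] mat_mult_one_dim)
  have right_cancel: "X = Y * F" if "X * E = Y" "E * F = 1\<^sub>m n" 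
    "dim_row X = n" "dim_col X = n" "dim_row E = n" "dim_col E = n" "dim_row F = n" "dim_col F = n" for X Y E F :: "real mat"
    using that by (auto simp: mat_assoc_dim mat_mult_one_dim)
  have left_cancel: "X = F * Y" if "E * X = Y" "F * E = 1\<^sub>m n" 
    "dim_row X = n" "dim_col X = n" "dim_row E = n" "dim_col E = n" "dim_row F = n" "dim_col F = n" for X Y E F :: "real mat"
    using that by (auto simp: mat_assoc_dim[symmetric] mat_mult_one_dim)
  have eq_uminus: "X = - Y" if "X + Y = 0\<^sub>m n n" "dim_row X = n" "dim_col X = n" "dim_row Y = n" "dim_col Y = n"
    for X Y :: "real mat"
  proof (rule eq_matI)
    fix i j assume "i < dim_row (- Y)" "j < dim_col (- Y)"
    then show "X $$ (i,j) = (- Y) $$ (i,j)"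
      using arg_cong[OF that(1), of "\<lambda>Z. Z $$ (i,j)"] that(2-) by auto
  qed (use that in auto)
  have eq_minus: "Y = Z - X" if "X + Y = Z" "dim_row X = n" "dim_col X = n" "dim_row Y = n" "dim_col Y = n"
    for X Y Z :: "real mat"
    unfolding that(1)[symmetric] using that(2-) by (intro eq_matI) auto
  have add_comm: "X + Y = Y + X" if "dim_row X = n" "dim_col X = n" "dim_row Y = n" "dim_col Y = n"
    for X Y :: "real mat"
    using that by (intro eq_matI) auto
  have add_uminus: "- Y + X = X - Y" "X + - Y = X - Y"
    if "dim_row X = n" "dim_col X = n" "dim_row Y = n" "dim_col Y = n" for X Y :: "real mat"
    using that by (auto intro!: eq_matI)
  show False
  proof (cases b)
    case True
    \<comment> \<open>\<open>N\<close> is the upper right block of the inner product. The outer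
      layers are lower triangular, so the upper right block of the whole is \<open>N * D5\<close>,
      which must vanish.\<close>
    define N where "N = D2 * A4 + (A2 * (A3 * A4) + A2 * D3)"
    have [simp]: "dim_row N = n" "dim_col N = n" by (simp_all add: N_def)
    have "?M = four_block_mat (1\<^sub>m n) (0\<^sub>m n n) A1 D1 * (four_block_mat
        (D2 * D4 + A2 * (A3 * D4)) N (A3 * D4) (A3 * A4 + D3) *
       four_block_mat (1\<^sub>m n) (0\<^sub>m n n) A5 D5)"
      unfolding M 1 2 3 4 5 N_def using True by (simp add: mat_dim_simps)
    also have "\<dots> = four_block_mat (D2 * D4 + A2 * (A3 * D4) + N * A5) (N * D5)
       (A1 * (D2 * D4 + A2 * (A3 * D4) + N * A5) + D1 * (A3 * D4 + (A3 * A4 + D3) * A5))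
       (A1 * (N * D5) + D1 * ((A3 * A4 + D3) * D5))"
      by (simp add: mat_dim_simps)
    finally have e: "1\<^sub>m n = D2 * D4 + A2 * (A3 * D4) + N * A5" "0\<^sub>m n n = N * D5"
       "W = A1 * (N * D5) + D1 * ((A3 * A4 + D3) * D5)"
      by (rule four_block_mat_inject[where n=n and k=n and l=n and m=n]; force intro!: carrier_matI)+
    have N0: "N = 0\<^sub>m n n"
      using right_cancel[OF e(2)[symmetric] E5(2)] by (simp add: mat_dim_simps)
    have "(D2 + A2 * A3) * D4 = 1\<^sub>m n"
      using e(1) by (simp add: N0 mat_dim_simps)
    from right_cancel[OF this E4(2)] have A23: "D2 + A2 * A3 = E4"
      by (simp add: mat_dim_simps)
    have "E4 * A4 + A2 * D3 = 0\<^sub>m n n"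
      using N0 unfolding N_def A23[symmetric] by (simp add: mat_dim_simps)
    then have "E4 * A4 = - (A2 * D3)" by (rule eq_uminus) (auto intro!: carrier_matI)
    from left_cancel[OF this E4(2)] have A4: "A4 = - (D4 * (A2 * D3))" by simp
    have "D1 * ((A3 * A4 + D3) * D5) = W" using e(3) by (simp add: e(2)[symmetric] mat_dim_simps)
    from left_cancel[OF this E1(3)] have "(A3 * A4 + D3) * D5 = E1 * W" by simp
    from right_cancel[OF this E5(2)] have "A3 * A4 + D3 = E1 * (W * E5)"
      by (simp add: mat_dim_simps)
    then have "(A3 * A4 + D3) * E3 = E1 * (W * E5) * E3" by simp
    then have "A3 * (A4 * E3) + 1\<^sub>m n = E1 * (W * (E5 * E3))" by (simp add: E3 mat_dim_simps)
    moreover have "A4 * E3 = - (D4 * A2)" by (simp add: A4 mat_dim_simps E3)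
    ultimately have "1\<^sub>m n - A3 * (D4 * A2) = E1 * (W * (E5 * E3))"
      by (simp add: add_uminus)
    then have "mat_trace (1\<^sub>m n) - mat_trace (A3 * (D4 * A2)) = mat_trace (E1 * (W * (E5 * E3)))"
      by (subst mat_trace_minus[symmetric, of _ n]) (auto intro!: carrier_matI)
    \<comment> \<open>Cyclicity gathers the diagonal factors behind \<open>W\<close>, and scaling
      its columns keeps the diagonal zero.\<close>
    also have "\<dots> = mat_trace (W * (E5 * E3 * E1))"
      by (subst mat_trace_mult_commute[of _ n n]) (auto intro!: carrier_matI simp: mat_dim_simps)
    also have "\<dots> = 0"
      by (intro mat_trace_mult_pos_diagonal_zero[of n] pos_diagonal_mult E1 E3 E5 W W0)
    \<comment> \<open>Cyclicity again turns the unknown product into \<open>A2 * A3\<close>, which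
      \<open>A23\<close> expresses through diagonal matrices.\<close>
    also have "mat_trace (A3 * (D4 * A2)) = mat_trace (D4 * (A2 * A3))"
      by (subst mat_trace_mult_commute[of _ n n]) (auto intro!: carrier_matI simp: mat_dim_simps)
    also have "A2 * A3 = E4 - D2"
      using A23 by (rule eq_minus) (auto intro!: carrier_matI)
    also have "D4 * (E4 - D2) = 1\<^sub>m n - D4 * D2" by (simp add: mat_dim_simps E4)
    also have "mat_trace (1\<^sub>m n - D4 * D2) = mat_trace (1\<^sub>m n) - mat_trace (D4 * D2)"
      by (intro mat_trace_minus) (auto intro!: carrier_matI)
    \<comment> \<open>The two copies of \<open>n\<close> cancel; what survives is the trace of a
      positive diagonal matrix.\<close>
    finally have "mat_trace (D4 * D2) = 0" by simp
    then show False
      using mat_trace_pos_diagonal[OF pos_diagonal_mult[OF 4(2) 2(2)]] n by simp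
  next
    case False
    \<comment> \<open>Mirror case: \<open>N\<close> is the lower left block of the inner product.
      Now \<open>W\<close> enters through \<open>A23\<close>, so solving for \<open>A4\<close> uses
      \<open>W'\<close>, and the positive diagonal matrix is \<open>E1 * (E5 * E3)\<close>.\<close>
    define N where "N = A2 * D3 + (A2 * (A3 * A4) + D2 * A4)"
    have [simp]: "dim_row N = n" "dim_col N = n" by (simp_all add: N_def)
    have "?M = four_block_mat D1 A1 (0\<^sub>m n n) (1\<^sub>m n) * (four_block_mat
        (D3 + A3 * A4) (A3 * D4) N ((A2 * A3 + D2) * D4) *
       four_block_mat D5 A5 (0\<^sub>m n n) (1\<^sub>m n))"
      unfolding M 1 2 3 4 5 N_def using False by (simp add: mat_dim_simps)
    also have "\<dots> = four_block_mat (D1 * ((D3 + A3 * A4) * D5) + A1 * (N * D5))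
       (D1 * ((D3 + A3 * A4) * A5 + A3 * D4) + A1 * (N * A5 + (A2 * A3 + D2) * D4))
       (N * D5) (N * A5 + (A2 * A3 + D2) * D4)"
      by (simp add: mat_dim_simps)
    finally have e: "1\<^sub>m n = D1 * ((D3 + A3 * A4) * D5) + A1 * (N * D5)" "0\<^sub>m n n = N * D5"
       "W = N * A5 + (A2 * A3 + D2) * D4"
      by (rule four_block_mat_inject[where n=n and k=n and l=n and m=n]; force intro!: carrier_matI)+
    have N0: "N = 0\<^sub>m n n"
      using right_cancel[OF e(2)[symmetric] E5(2)] by (simp add: mat_dim_simps)
    have "(A2 * A3 + D2) * D4 = W"
      using e(3) by (simp add: N0 mat_dim_simps)
    from right_cancel[OF this E4(2)] have A23: "A2 * A3 + D2 = W * E4"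
      by (simp add: mat_dim_simps)
    have "W * (E4 * A4) + A2 * D3 = (A2 * A3 + D2) * A4 + A2 * D3"
      unfolding A23 by (simp add: mat_dim_simps)
    also have "\<dots> = N" unfolding N_def
      using add_comm[of "A2 * D3" "A2 * (A3 * A4) + D2 * A4"] by (simp add: mat_dim_simps)
    finally have "W * (E4 * A4) + A2 * D3 = 0\<^sub>m n n" using N0 by simp
    then have "W * (E4 * A4) = - (A2 * D3)" by (rule eq_uminus) (auto intro!: carrier_matI)
    from left_cancel[OF this W(3)] have "E4 * A4 = - (W' * (A2 * D3))" by simp
    from left_cancel[OF this E4(2)] have A4: "A4 = - (D4 * (W' * (A2 * D3)))" by simp
    have "D1 * ((D3 + A3 * A4) * D5) = 1\<^sub>m n" using e(1) by (simp add: e(2)[symmetric] mat_dim_simps)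
    from left_cancel[OF this E1(3)] have "(D3 + A3 * A4) * D5 = E1"
      by (simp add: mat_dim_simps)
    from right_cancel[OF this E5(2)] have "D3 + A3 * A4 = E1 * E5"
      by simp
    then have "(D3 + A3 * A4) * E3 = E1 * E5 * E3" by simp
    then have "1\<^sub>m n + A3 * (A4 * E3) = E1 * (E5 * E3)" by (simp add: E3 mat_dim_simps)
    moreover have "A4 * E3 = - (D4 * (W' * A2))" by (simp add: A4 mat_dim_simps E3)
    ultimately have "1\<^sub>m n - A3 * (D4 * (W' * A2)) = E1 * (E5 * E3)"
      by (simp add: add_uminus)
    then have "mat_trace (1\<^sub>m n) - mat_trace (A3 * (D4 * (W' * A2))) = mat_trace (E1 * (E5 * E3))"
      by (subst mat_trace_minus[symmetric, of _ n]) (auto intro!: carrier_matI)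
    also have "mat_trace (A3 * (D4 * (W' * A2))) = mat_trace (D4 * (W' * (A2 * A3)))"
      by (subst mat_trace_mult_commute[of _ n n]) (auto intro!: carrier_matI simp: mat_dim_simps)
    also have "A2 * A3 = W * E4 - D2"
      using A23 add_comm[of "A2 * A3" D2] by (intro eq_minus) auto
    also have "D4 * (W' * (W * E4 - D2)) = 1\<^sub>m n - D4 * (W' * D2)"
      by (simp add: mat_dim_simps E4 cancel[OF W(3)])
    also have "mat_trace (1\<^sub>m n - D4 * (W' * D2)) = mat_trace (1\<^sub>m n) - mat_trace (D4 * (W' * D2))"
      by (intro mat_trace_minus) (auto intro!: carrier_matI)
    also have "mat_trace (D4 * (W' * D2)) = mat_trace (W' * (D2 * D4))"
      by (subst mat_trace_mult_commute[of _ n n]) (auto intro!: carrier_matI simp: mat_dim_simps)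
    also have "\<dots> = 0"
      by (intro mat_trace_mult_pos_diagonal_zero[of n] pos_diagonal_mult 4 2 W W'0)
    finally have "mat_trace (E1 * (E5 * E3)) = 0" by simp
    then show False
      using mat_trace_pos_diagonal[OF pos_diagonal_mult[OF E1(1) pos_diagonal_mult[OF E5(1) E3(1)]]] n
      by simp
  qed
qed

lemma five_layers_insufficient:
  assumes "n > 1"
  shows "\<exists>M \<in> SL (2 * n). \<not> represented_by_depth n 5 M"
proof -
  obtain W W' :: "real mat"
    where W: "W \<in> carrier_mat n n" "W' \<in> carrier_mat n n" "W' * W = 1\<^sub>m n" "det W = 1"
    and W0: "\<And>i. i < n \<Longrightarrow> W $$ (i, i) = 0" "\<And>i. i < n \<Longrightarrow> W' $$ (i, i) = 0"
    using exists_hollow_inverse_pair[OF assms] by metis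
  let ?M = "four_block_mat (1\<^sub>m n) (0\<^sub>m n n) (0\<^sub>m n n) W"
  have "det ?M = 1"
    using W by (subst det_four_block_mat_upper_right_zero[of _ n _ n]) auto
  then have "?M \<in> SL (2 * n)" using W by (auto simp: SL_def mult_2)
  moreover have "\<not> represented_by_depth n 5 ?M"
    using four_block_one_hollow_not_alternating[OF assms W(1-3) W0]
      represented_by_depth_imp_alternating by blast
  ultimately show ?thesis ..
qed

section \<open>Similarity of a matrix and its left multiple\<close>

lemma mat_smult_mult_dim:
  fixes A :: "'a::comm_semiring_0 mat"
  assumes "dim_col A = dim_row B"
  shows "(k \<cdot>\<^sub>m A) * B = k \<cdot>\<^sub>m (A * B)" "A * (k \<cdot>\<^sub>m B) = k \<cdot>\<^sub>m (A * B)"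
proof -
  show "(k \<cdot>\<^sub>m A) * B = k \<cdot>\<^sub>m (A * B)"
    by (rule mult_smult_assoc_mat[of A "dim_row A" "dim_row B" B "dim_col B" k]) (use assms in auto)
  show "A * (k \<cdot>\<^sub>m B) = k \<cdot>\<^sub>m (A * B)"
    by (rule mult_smult_distrib[of A "dim_row A" "dim_row B" B "dim_col B" k]) (use assms in auto)
qed

lemma det_nonzero_inverse:
  fixes A :: "'a::field mat"
  assumes "A \<in> carrier_mat n n" "det A \<noteq> 0"
  obtains B where "B \<in> carrier_mat n n" "A * B = 1\<^sub>m n" "B * A = 1\<^sub>m n"
  \<comment> \<open>\<open>undefined\<close> fills the record extension slot of
    \<open>ring_mat\<close>.\<close>
  using det_non_zero_imp_unit[OF assms, of undefined] unfolding Units_def ring_mat_def by auto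

text \<open>Vectors appear as one-column matrices so that the block laws apply to them; a left
  inverse row acts as a linear functional with value one on \<open>c\<close>.\<close>

lemma exists_left_inverse_column:
  fixes c :: "real mat"
  assumes "c \<in> carrier_mat k 1" "c \<noteq> 0\<^sub>m k 1"
  obtains w where "w \<in> carrier_mat 1 k" "w * c = 1\<^sub>m 1"
proof -
  have "\<exists>i<k. c $$ (i, 0) \<noteq> 0"
  proof (rule ccontr)
    assume "\<not> ?thesis"
    then have "c = 0\<^sub>m k 1" using assms(1) by (intro eq_matI) auto
    with assms(2) show False ..
  qed
  then obtain i where i: "i < k" "c $$ (i, 0) \<noteq> 0" by blast
  define w where "w = mat 1 k (\<lambda>(_,j). if j = i then 1 / c $$ (i, 0) else 0)"
  have "(w * c) $$ (0,0) = (\<Sum>j<k. w $$ (0,j) * c $$ (j,0))"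
    using assms(1) by (simp add: w_def scalar_prod_def lessThan_atLeast0)
  also have "\<dots> = (\<Sum>j<k. if j = i then 1 else 0)"
    using i by (intro sum.cong) (auto simp: w_def)
  finally have "(w * c) $$ (0,0) = 1" using i by simp
  then have "w * c = 1\<^sub>m 1"
    using assms(1) by (intro eq_matI) (auto simp: w_def)
  then show thesis using that[of w] by (simp add: w_def)
qed

text \<open>Take a functional \<open>w\<close> with \<open>w * z = 1\<close> and
  \<open>w * e\<close> nonzero. Then \<open>1 - (z - e) * w\<close> sends \<open>z\<close> to
  \<open>e\<close>; being a rank-one change of the identity, it has an inverse of the same kind,
  obtained by dividing by \<open>w * e\<close>.\<close>

lemma exists_invertible_mapping_column:
  fixes e z :: "real mat"
  assumes e: "e \<in> carrier_mat n 1" "e \<noteq> 0\<^sub>m n 1" and z: "z \<in> carrier_mat n 1" "z \<noteq> 0\<^sub>m n 1"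
  obtains g h where "g \<in> carrier_mat n n" "h \<in> carrier_mat n n"
    "g * h = 1\<^sub>m n" "h * g = 1\<^sub>m n" "g * e = z" "h * z = e"
proof -
  obtain v where v: "v \<in> carrier_mat 1 n" "v * z = 1\<^sub>m 1"
    using exists_left_inverse_column[OF z] .
  obtain t where t: "t \<in> carrier_mat 1 n" "t * e = 1\<^sub>m 1"
    using exists_left_inverse_column[OF e] .
  obtain w where w: "w \<in> carrier_mat 1 n" "w * z = 1\<^sub>m 1" "w * e \<noteq> 0\<^sub>m 1 1"
  proof (cases "v * e = 0\<^sub>m 1 1")
    case False
    with v show thesis by (intro that)
  next
    case True
    \<comment> \<open>The correction to \<open>v\<close> vanishes on \<open>z\<close> and takes
      \<open>e\<close> to \<open>t * e = 1\<close>, because \<open>v * e = 0\<close> here.\<close>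
    define w where "w = v + (t - t * z * v)"
    have "w \<in> carrier_mat 1 n" using v t z by (auto simp: w_def)
    moreover have "w * z = v * z + (t * z - t * z)"
      using v t z(1) e(1) unfolding w_def by (auto simp: mat_dim_simps)
    then have "w * z = 1\<^sub>m 1" using v t z(1) by (auto simp: minus_r_inv_mat[of _ 1 1])
    moreover have "w * e = 1\<^sub>m 1 - 0\<^sub>m 1 1"
      using v t z(1) e(1) True unfolding w_def by (auto simp: mat_dim_simps)
    then have "(w * e) $$ (0,0) = 1" by simp
    then have "w * e \<noteq> 0\<^sub>m 1 1" by auto
    ultimately show thesis by (rule that)
  qed
  have we: "w * e \<in> carrier_mat 1 1" using w(1) e(1) by auto
  obtain x where x: "x \<in> carrier_mat 1 1" "x * (w * e) = 1\<^sub>m 1"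
    using exists_left_inverse_column[OF we w(3)] .
  have dims [simp]: "dim_row e = n" "dim_col e = 1" "dim_row z = n" "dim_col z = 1" "dim_row w = 1"
    "dim_col w = n" "dim_row x = 1" "dim_col x = 1"
    using e z w x by auto
  define u where "u = z - e"
  have u [simp]: "dim_row u = n" "dim_col u = 1" by (simp_all add: u_def)
  have wu: "w * u = 1\<^sub>m 1 - w * e" by (simp add: u_def mat_mult_minus_dim w)
  define g where "g = 1\<^sub>m n + u * (x * w)"
  define h where "h = 1\<^sub>m n - u * w"
  have c: "g \<in> carrier_mat n n" "h \<in> carrier_mat n n" by (auto simp: g_def h_def)
  have ge: "g * e = z"
  proof -
    have "g * e = e + u" by (simp add: g_def mat_dim_simps x)
    also have "\<dots> = z" unfolding u_def by (rule eq_matI) auto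
    finally show ?thesis .
  qed
  have hz: "h * z = e"
  proof -
    have "h * z = z - u" by (simp add: h_def mat_dim_simps w)
    also have "\<dots> = e" unfolding u_def by (rule eq_matI) auto
    finally show ?thesis .
  qed
  have "h * g = h + h * u * (x * w)"
    using c by (simp add: g_def mat_assoc_dim mat_mult_add_dim mat_mult_one_dim)
  also have "h * u = u * (w * e)"
  proof -
    have "h * u = u - (u - u * (w * e))"
      by (simp add: h_def mat_dim_simps wu)
    also have "\<dots> = u * (w * e)"
      by (rule eq_matI) (auto simp del: index_mult_mat(1))
    finally show ?thesis .
  qed
  also have "u * (w * e) * (x * w) = u * (w * e * x * w)" by (simp add: mat_assoc_dim)
  also have "w * e * x = 1\<^sub>m 1" by (rule mat_mult_left_right_inverse[OF x(1) we x(2)])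
  also have "h + u * (1\<^sub>m 1 * w) = 1\<^sub>m n"
    by (auto simp: h_def mat_mult_one_dim simp del: index_mult_mat(1) intro!: eq_matI)
  finally have hg: "h * g = 1\<^sub>m n" .
  have gh: "g * h = 1\<^sub>m n" using mat_mult_left_right_inverse[OF c(2,1) hg] .
  show thesis using that[OF c gh hg ge hz] .
qed

text \<open>Since \<mu> is not an eigenvalue of \<open>D\<close>, the equation
  \<open>x * D - \<mu> \<cdot>\<^sub>m x = b\<close> is solvable; conjugation by the unipotent
  matrix with block \<open>x\<close> then removes \<open>b\<close>.\<close>

lemma similar_mat_upper_block:
  fixes b :: "real mat"
  assumes b: "b \<in> carrier_mat 1 k" and D: "D \<in> carrier_mat k k" and det: "det (D - \<mu> \<cdot>\<^sub>m 1\<^sub>m k) \<noteq> 0"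
  shows "similar_mat (four_block_mat (\<mu> \<cdot>\<^sub>m 1\<^sub>m 1) b (0\<^sub>m k 1) D)
    (four_block_mat (\<mu> \<cdot>\<^sub>m 1\<^sub>m 1) (0\<^sub>m 1 k) (0\<^sub>m k 1) D)"
proof -
  obtain E where E: "E \<in> carrier_mat k k" "E * (D - \<mu> \<cdot>\<^sub>m 1\<^sub>m k) = 1\<^sub>m k"
    using det_nonzero_inverse[OF _ det, of k] D by (metis minus_carrier_mat one_carrier_mat smult_carrier_mat)
  define x where "x = b * E"
  have [simp]: "dim_row x = 1" "dim_col x = k" "dim_row b = 1" "dim_col b = k" "dim_row D = k"
    "dim_col D = k" "dim_row E = k" "dim_col E = k"
    using b D E by (auto simp: x_def)
  have "b = x * (D - \<mu> \<cdot>\<^sub>m 1\<^sub>m k)" by (simp add: x_def mat_assoc_dim E mat_mult_one_dim)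
  also have "\<dots> = x * D - \<mu> \<cdot>\<^sub>m x" by (simp add: mat_dim_simps mat_smult_mult_dim)
  finally have bx: "b = x * D - \<mu> \<cdot>\<^sub>m x" .
  have b': "b = x * D + - (\<mu> \<cdot>\<^sub>m x)" "b = - (\<mu> \<cdot>\<^sub>m x) + x * D" unfolding bx
    by (auto intro!: eq_matI simp del: index_mult_mat(1))
  have "similar_mat_wit (four_block_mat (\<mu> \<cdot>\<^sub>m 1\<^sub>m 1) b (0\<^sub>m k 1) D)
    (four_block_mat (\<mu> \<cdot>\<^sub>m 1\<^sub>m 1) (0\<^sub>m 1 k) (0\<^sub>m k 1) D)
    (four_block_mat (1\<^sub>m 1) x (0\<^sub>m k 1) (1\<^sub>m k))
    (four_block_mat (1\<^sub>m 1) (- x) (0\<^sub>m k 1) (1\<^sub>m k))"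
    by (rule similar_mat_witI[where n="1 + k"])
       (auto simp: mat_dim_simps mat_smult_mult_dim b'[symmetric] intro!: carrier_matI)
  then show ?thesis unfolding similar_mat_def by blast
qed

text \<open>The same argument on the other side, solving
  \<open>D * y - \<mu> \<cdot>\<^sub>m y = c\<close>.\<close>

lemma similar_mat_lower_block:
  fixes c :: "real mat"
  assumes c: "c \<in> carrier_mat k 1" and D: "D \<in> carrier_mat k k" and det: "det (D - \<mu> \<cdot>\<^sub>m 1\<^sub>m k) \<noteq> 0"
  shows "similar_mat (four_block_mat (\<mu> \<cdot>\<^sub>m 1\<^sub>m 1) (0\<^sub>m 1 k) c D)
    (four_block_mat (\<mu> \<cdot>\<^sub>m 1\<^sub>m 1) (0\<^sub>m 1 k) (0\<^sub>m k 1) D)"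
proof -
  obtain E where E: "E \<in> carrier_mat k k" "(D - \<mu> \<cdot>\<^sub>m 1\<^sub>m k) * E = 1\<^sub>m k"
    using det_nonzero_inverse[OF _ det, of k] D by (metis minus_carrier_mat one_carrier_mat smult_carrier_mat)
  define y where "y = E * c"
  have [simp]: "dim_row y = k" "dim_col y = 1" "dim_row c = k" "dim_col c = 1" "dim_row D = k"
    "dim_col D = k" "dim_row E = k" "dim_col E = k"
    using c D E by (auto simp: y_def)
  have "c = (D - \<mu> \<cdot>\<^sub>m 1\<^sub>m k) * y"
    by (simp add: y_def mat_assoc_dim[symmetric] E mat_mult_one_dim)
  also have "\<dots> = D * y - \<mu> \<cdot>\<^sub>m y" by (simp add: mat_dim_simps mat_smult_mult_dim)
  also have "\<dots> = \<mu> \<cdot>\<^sub>m - y + D * y"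
    by (auto intro!: eq_matI simp del: index_mult_mat(1))
  finally have c': "c = \<mu> \<cdot>\<^sub>m - y + D * y" .
  have "similar_mat_wit (four_block_mat (\<mu> \<cdot>\<^sub>m 1\<^sub>m 1) (0\<^sub>m 1 k) c D)
    (four_block_mat (\<mu> \<cdot>\<^sub>m 1\<^sub>m 1) (0\<^sub>m 1 k) (0\<^sub>m k 1) D)
    (four_block_mat (1\<^sub>m 1) (0\<^sub>m 1 k) (- y) (1\<^sub>m k))
    (four_block_mat (1\<^sub>m 1) (0\<^sub>m 1 k) y (1\<^sub>m k))"
    by (rule similar_mat_witI[where n="1 + k"])
       (auto simp: mat_dim_simps mat_smult_mult_dim c'[symmetric] intro!: carrier_matI)
  then show ?thesis unfolding similar_mat_def by blast
qed

text \<open>With the non-eigenvector \<open>v\<close> as first basis vector the column below the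
  corner is nonzero, and a unipotent conjugation can use that column to change the corner to
  one.\<close>

lemma similar_mat_one_block:
  fixes G :: "real mat"
  assumes G: "G \<in> carrier_mat (1 + k) (1 + k)" and v: "v \<in> carrier_mat (1 + k) 1"
    and nonscalar: "\<And>\<kappa>. G * v \<noteq> \<kappa> \<cdot>\<^sub>m v"
  obtains r c G1 where "r \<in> carrier_mat 1 k" "c \<in> carrier_mat k 1" "G1 \<in> carrier_mat k k"
    "similar_mat G (four_block_mat (1\<^sub>m 1) r c G1)" "c \<noteq> 0\<^sub>m k 1"
proof -
  \<comment> \<open>The first unit vector, written with blocks of width zero so that it can enter
    block products.\<close>
  let ?e = "four_block_mat (1\<^sub>m 1) (0\<^sub>m 1 0) (0\<^sub>m k 1) (0\<^sub>m k 0) :: real mat"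
  have e: "?e \<in> carrier_mat (1 + k) 1" by auto
  have "?e $$ (0,0) = 1" by simp
  moreover have "(0\<^sub>m (1 + k) 1 :: real mat) $$ (0,0) = 0" by simp
  ultimately have e0: "?e \<noteq> 0\<^sub>m (1 + k) 1" by (metis zero_neq_one)
  have v0: "v \<noteq> 0\<^sub>m (1 + k) 1"
    using nonscalar[of 0] G by auto
  obtain g h where gh: "g \<in> carrier_mat (1 + k) (1 + k)" "h \<in> carrier_mat (1 + k) (1 + k)"
    "g * h = 1\<^sub>m (1 + k)" "h * g = 1\<^sub>m (1 + k)" "g * ?e = v" "h * v = ?e"
    using exists_invertible_mapping_column[OF e e0 v v0] .
  have [simp]: "dim_row g = 1 + k" "dim_col g = 1 + k" "dim_row h = 1 + k" "dim_col h = 1 + k"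
    "dim_row G = 1 + k" "dim_col G = 1 + k" "dim_row v = 1 + k" "dim_col v = 1" using gh G v by auto
  define H where "H = h * G * g"
  obtain a r c G1 where split: "split_block H 1 1 = (a, r, c, G1)" by (metis prod_cases4)
  have blk: "a \<in> carrier_mat 1 1" "r \<in> carrier_mat 1 k" "c \<in> carrier_mat k 1" "G1 \<in> carrier_mat k k"
    and Hb: "H = four_block_mat a r c G1"
    using split_block[OF split, of k k] by (auto simp: H_def)
  have a: "a = (a $$ (0,0)) \<cdot>\<^sub>m 1\<^sub>m 1" using blk(1) by (intro eq_matI) auto
  have GH: "G * g = g * H"
    by (simp add: H_def mat_assoc_dim[symmetric] gh mat_mult_one_dim)
  have c0: "c \<noteq> 0\<^sub>m k 1"
  \<comment> \<open>If \<open>c\<close> vanished, \<open>?e\<close> would be an eigenvector of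
    \<open>H\<close>, and so \<open>v = g * ?e\<close> one of \<open>G\<close>.\<close>
  proof
    assume c: "c = 0\<^sub>m k 1"
    have "H * ?e = four_block_mat a (0\<^sub>m 1 0) (0\<^sub>m k 1) (0\<^sub>m k 0)"
      unfolding Hb c using blk by (simp add: mat_dim_simps)
    also have "\<dots> = (a $$ (0,0)) \<cdot>\<^sub>m ?e"
      by (subst smult_four_block_mat[of _ 1 1 _ 0 _ k]) (use a in auto)
    finally have He: "H * ?e = (a $$ (0,0)) \<cdot>\<^sub>m ?e" .
    have "G * v = G * g * ?e" unfolding gh(5)[symmetric] using e by (simp add: mat_assoc_dim)
    also have "\<dots> = g * (H * ?e)" unfolding GH by (simp add: mat_assoc_dim H_def)
    also have "\<dots> = (a $$ (0,0)) \<cdot>\<^sub>m v" unfolding He gh(5)[symmetric] by (simp add: mat_smult_mult_dim)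
    finally show False using nonscalar by blast
  qed
  obtain w where w: "w \<in> carrier_mat 1 k" "w * c = 1\<^sub>m 1"
    using exists_left_inverse_column[OF blk(3) c0] .
  \<comment> \<open>Conjugation by \<open>?U\<close> turns the corner into \<open>a + x * c\<close>;
    as \<open>w * c = 1\<close>, this choice makes it one.\<close>
  define x where "x = (1 - a $$ (0,0)) \<cdot>\<^sub>m w"
  have [simp]: "dim_row x = 1" "dim_col x = k" "dim_row w = 1" "dim_col w = k" "dim_row a = 1"
    "dim_col a = 1" "dim_row r = 1" "dim_col r = k" "dim_row c = k" "dim_col c = 1" "dim_row G1 = k"
    "dim_col G1 = k"
    using w blk by (auto simp: x_def)
  have xc: "a + x * c = 1\<^sub>m 1"
    by (subst a) (auto simp: x_def mat_smult_mult_dim w intro!: eq_matI)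
  let ?U = "four_block_mat (1\<^sub>m 1) x (0\<^sub>m k 1) (1\<^sub>m k)"
  let ?U' = "four_block_mat (1\<^sub>m 1) (- x) (0\<^sub>m k 1) (1\<^sub>m k)"
  have U: "?U * ?U' = 1\<^sub>m (1 + k)" "?U' * ?U = 1\<^sub>m (1 + k)"
    by (auto simp: mat_dim_simps)
  define K where "K = four_block_mat (1\<^sub>m 1) (- x + (r + x * G1)) c (- (c * x) + G1)"
  have "?U * H = four_block_mat (a + x * c) (r + x * G1) c G1"
    unfolding Hb by (simp add: mat_mult_four_block_dim mat_mult_one_dim mat_mult_zero_dim mat_add_zero_dim)
  then have "?U * H * ?U' = K"
    unfolding K_def xc by (simp add: mat_dim_simps)
  then have K: "K = (?U * h) * G * (g * ?U')"
    by (simp add: H_def mat_assoc_dim)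
  have gh': "h * (g * X) = X" "g * (h * X) = X" if "dim_row X = 1 + k" for X
    using that gh by (simp_all add: mat_assoc_dim[symmetric] mat_mult_one_dim)
  have UU': "?U' * (?U * X) = X" if "dim_row X = 1 + k" for X
    using that U by (simp add: mat_assoc_dim[symmetric] mat_mult_one_dim)
  have "similar_mat_wit K G (?U * h) (g * ?U')"
  proof (rule similar_mat_witI[OF _ _ K])
    show "?U * h * (g * ?U') = 1\<^sub>m (1 + k)" "g * ?U' * (?U * h) = 1\<^sub>m (1 + k)"
      using U gh(3) UU'[of h] gh'(1)[of ?U'] by (simp_all add: mat_assoc_dim)
  qed (auto simp: K_def intro!: carrier_matI)
  then have "similar_mat G K" unfolding similar_mat_def using similar_mat_wit_sym by blast
  then show thesis unfolding K_def
    by (rule that[rotated 3]) (use c0 in \<open>auto intro!: carrier_matI\<close>)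
qed

section \<open>Making the Schur complement nonscalar\<close>

lemma exists_orthogonal_column:
  fixes c :: "real mat"
  assumes c: "c \<in> carrier_mat k 1" and k: "k \<ge> 2"
  obtains z where "z \<in> carrier_mat k 1" "z \<noteq> 0\<^sub>m k 1" "transpose_mat z * c = 0\<^sub>m 1 1"
proof -
  \<comment> \<open>A unit vector if \<open>c\<close> starts with zero; otherwise a quarter turn of
    the first two coordinates.\<close>
  define f where "f i = (if c $$ (0,0) = 0 then (if i = 0 then 1 else 0)
    else if i = 0 then - c $$ (1,0) else if i = 1 then c $$ (0,0) else (0::real))" for i :: nat
  define z where "z = mat k 1 (\<lambda>(i,_). f i)"
  have "(transpose_mat z * c) $$ (0,0) = (\<Sum>i<k. f i * c $$ (i,0))"
    using c by (simp add: z_def scalar_prod_def lessThan_atLeast0)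
  also have "\<dots> = (\<Sum>i\<in>{0,1}. f i * c $$ (i,0))"
    by (rule sum.mono_neutral_right) (use k in \<open>auto simp: f_def\<close>)
  also have "\<dots> = 0" by (simp add: f_def)
  finally have "transpose_mat z * c = 0\<^sub>m 1 1"
    using c by (intro eq_matI) (auto simp: z_def)
  moreover have "z $$ (if c $$ (0,0) = 0 then 0 else 1, 0) \<noteq> 0"
    using k by (auto simp: z_def f_def)
  then have "z \<noteq> 0\<^sub>m k 1" using k by (auto split: if_splits)
  ultimately show thesis using that[of z] by (simp add: z_def)
qed

lemma transpose_mult_self_column:
  fixes z :: "real mat"
  assumes "z \<in> carrier_mat k 1" "z \<noteq> 0\<^sub>m k 1"
  obtains t where "t > 0" "transpose_mat z * z = t \<cdot>\<^sub>m 1\<^sub>m 1"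
proof -
  have "(transpose_mat z * z) $$ (0,0) = (\<Sum>i<k. (z $$ (i,0))\<^sup>2)"
    using assms(1) by (simp add: scalar_prod_def lessThan_atLeast0 power2_eq_square)
  moreover have "\<exists>i<k. z $$ (i,0) \<noteq> 0"
  proof (rule ccontr)
    assume "\<not> ?thesis"
    then have "z = 0\<^sub>m k 1" using assms(1) by (intro eq_matI) auto
    with assms(2) show False ..
  qed
  then have "(\<Sum>i<k. (z $$ (i,0))\<^sup>2) > 0"
    by (auto intro!: sum_pos2)
  moreover have "transpose_mat z * z = ((transpose_mat z * z) $$ (0,0)) \<cdot>\<^sub>m 1\<^sub>m 1"
    using assms(1) by (intro eq_matI) auto
  ultimately show thesis using that by metis
qed

text \<open>Conjugation by the unipotent matrix with row \<open>w\<close>, where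
  \<open>w * c = 0\<close>, keeps the corner and \<open>c\<close> but subtracts
  \<open>c * w * G\<close> from the Schur complement. If every vector was an eigenvector before, the
  transpose of \<open>w\<close> no longer is. This supplies the nonscalar hypothesis in the
  induction on the size.\<close>

lemma similar_one_block_nonscalar_schur:
  fixes G :: "real mat"
  assumes r: "r \<in> carrier_mat 1 k" and c: "c \<in> carrier_mat k 1" "c \<noteq> 0\<^sub>m k 1"
    and G: "G \<in> carrier_mat k k" and k: "k \<ge> 2" and det: "det (G - c * r) \<noteq> 0"
  obtains r' G' where "r' \<in> carrier_mat 1 k" "G' \<in> carrier_mat k k"
    "similar_mat (four_block_mat (1\<^sub>m 1) r c G) (four_block_mat (1\<^sub>m 1) r' c G')"
    "\<exists>v \<in> carrier_mat k 1. \<forall>\<kappa>. (G' - c * r') * v \<noteq> \<kappa> \<cdot>\<^sub>m v"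
proof (cases "\<exists>v \<in> carrier_mat k 1. \<forall>\<kappa>. (G - c * r) * v \<noteq> \<kappa> \<cdot>\<^sub>m v")
  case True
  moreover have "similar_mat (four_block_mat (1\<^sub>m 1) r c G) (four_block_mat (1\<^sub>m 1) r c G)"
    by (rule similar_mat_refl[of _ "1 + k"]) (use r c G in auto)
  ultimately show thesis using r G by (intro that[of r G])
next
  case False
  obtain z where z: "z \<in> carrier_mat k 1" "z \<noteq> 0\<^sub>m k 1" "transpose_mat z * c = 0\<^sub>m 1 1"
    using exists_orthogonal_column[OF c(1) k] .
  obtain t where t: "t > 0" "transpose_mat z * z = t \<cdot>\<^sub>m 1\<^sub>m 1"
    using transpose_mult_self_column[OF z(1,2)] .
  obtain s where s: "(G - c * r) * z = s \<cdot>\<^sub>m z" using False z(1) by blast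
  define w where "w = transpose_mat z"
  have [simp]: "dim_row w = 1" "dim_col w = k" "dim_row z = k" "dim_col z = 1" "dim_row c = k"
    "dim_col c = 1" "dim_row r = 1" "dim_col r = k" "dim_row G = k" "dim_col G = k"
    using z c r G by (auto simp: w_def)
  have wc: "w * c = 0\<^sub>m 1 1" and wz: "w * z = t \<cdot>\<^sub>m 1\<^sub>m 1" using z t by (simp_all add: w_def)
  have s0: "s \<noteq> 0"
  proof
    assume "s = 0"
    obtain B where B: "B \<in> carrier_mat k k" "B * (G - c * r) = 1\<^sub>m k"
      using det_nonzero_inverse[OF _ det, of k] by (metis \<open>dim_row c = k\<close> \<open>dim_col r = k\<close>
          carrier_mat_triv index_minus_mat(2,3) index_mult_mat(2,3))
    have "z = B * (G - c * r) * z" using B by (simp add: mat_mult_one_dim)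
    also have "\<dots> = B * ((G - c * r) * z)" using B(1) by (simp add: mat_assoc_dim)
    also have "\<dots> = 0\<^sub>m k 1" using \<open>s = 0\<close> B(1) unfolding s by (auto simp: mat_smult_mult_dim)
    finally show False using z(2) by simp
  qed
  define r' where "r' = - w + (r + w * G)"
  define G' where "G' = - (c * w) + G"
  let ?U = "four_block_mat (1\<^sub>m 1) w (0\<^sub>m k 1) (1\<^sub>m k)"
  let ?U' = "four_block_mat (1\<^sub>m 1) (- w) (0\<^sub>m k 1) (1\<^sub>m k)"
  have "similar_mat_wit (four_block_mat (1\<^sub>m 1) r' c G') (four_block_mat (1\<^sub>m 1) r c G) ?U ?U'"
    by (rule similar_mat_witI[where n="1 + k"])
       (auto simp: mat_dim_simps wc r'_def G'_def intro!: carrier_matI)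
  then have sim: "similar_mat (four_block_mat (1\<^sub>m 1) r c G) (four_block_mat (1\<^sub>m 1) r' c G')"
    unfolding similar_mat_def using similar_mat_wit_sym by blast
  have "w * ((G - c * r) * z) = w * (G * z)"
    by (simp add: mat_minus_mult_dim mat_mult_minus_dim mat_assoc_dim[symmetric, of w c] mat_assoc_dim[of c r] wc mat_mult_zero_dim)
       (auto intro!: eq_matI simp del: index_mult_mat(1))
  then have "w * (G * z) = s \<cdot>\<^sub>m (t \<cdot>\<^sub>m 1\<^sub>m 1)" unfolding s by (simp add: mat_smult_mult_dim wz)
  also have "\<dots> = (s * t) \<cdot>\<^sub>m 1\<^sub>m 1" by (rule eq_matI) auto
  finally have wGz: "w * (G * z) = (s * t) \<cdot>\<^sub>m 1\<^sub>m 1" .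
  have "(G' - c * r') * z = (G - c * r) * z - c * (w * (G * z))"
    unfolding G'_def r'_def
    by (simp add: mat_dim_simps) (auto intro!: eq_matI simp del: index_mult_mat(1))
  then have S'z: "(G' - c * r') * z = s \<cdot>\<^sub>m z - (s * t) \<cdot>\<^sub>m c"
    unfolding s wGz by (simp add: mat_smult_mult_dim mat_mult_one_dim)
  \<comment> \<open>Applying \<open>w\<close> to an eigenvalue equation gives
    \<open>\<kappa> = s\<close>; what remains is that \<open>s * t\<close> times \<open>c\<close> is
    zero, contrary to \<open>c\<close> being nonzero.\<close>
  have "(G' - c * r') * z \<noteq> \<kappa> \<cdot>\<^sub>m z" for \<kappa>
  proof
    assume eq: "(G' - c * r') * z = \<kappa> \<cdot>\<^sub>m z"
    have "w * (s \<cdot>\<^sub>m z - (s * t) \<cdot>\<^sub>m c) = w * (\<kappa> \<cdot>\<^sub>m z)" using eq S'z by simp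
    then have "s \<cdot>\<^sub>m (t \<cdot>\<^sub>m 1\<^sub>m 1) - 0\<^sub>m 1 1 = \<kappa> \<cdot>\<^sub>m (t \<cdot>\<^sub>m 1\<^sub>m 1)"
      by (simp add: mat_mult_minus_dim mat_smult_mult_dim wc wz)
    from arg_cong[OF this, of "\<lambda>X. X $$ (0,0)"] have "\<kappa> = s" using t(1) by simp
    have "c = 0\<^sub>m k 1"
    proof (rule eq_matI)
      fix i j assume "i < dim_row (0\<^sub>m k 1 :: real mat)" "j < dim_col (0\<^sub>m k 1 :: real mat)"
      then show "c $$ (i,j) = 0\<^sub>m k 1 $$ (i,j)"
        using arg_cong[OF trans[OF S'z[symmetric] eq], of "\<lambda>X. X $$ (i,j)"] \<open>\<kappa> = s\<close> s0 t(1) by simp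
    qed auto
    with c(2) show False ..
  qed
  then show thesis using z(1)
    by (intro that[OF _ _ sim]) (auto simp: r'_def G'_def intro!: carrier_matI)
qed

section \<open>Similarity of \<open>G * Q\<close> and \<open>Q\<close> by induction on the
  size\<close>

lemma det_similar_minus_smult:
  fixes A :: "real mat"
  assumes sim: "similar_mat A B" and A: "A \<in> carrier_mat n n"
  shows "det (A - \<mu> \<cdot>\<^sub>m 1\<^sub>m n) = det (B - \<mu> \<cdot>\<^sub>m 1\<^sub>m n)"
proof -
  obtain P P' where "similar_mat_wit A B P P'" using sim by (auto simp: similar_mat_def)
  note w = similar_mat_witD2[OF A this]
  have [simp]: "dim_row P = n" "dim_col P = n" "dim_row P' = n" "dim_col P' = n" "dim_row B = n" "dim_col B = n"
    using w by auto
  have "A - \<mu> \<cdot>\<^sub>m 1\<^sub>m n = P * (B - \<mu> \<cdot>\<^sub>m 1\<^sub>m n) * P'"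
    by (simp add: mat_dim_simps mat_smult_mult_dim w(1) w(3))
  then have "similar_mat_wit (A - \<mu> \<cdot>\<^sub>m 1\<^sub>m n) (B - \<mu> \<cdot>\<^sub>m 1\<^sub>m n) P P'"
    by (intro similar_mat_witI[OF w(1,2)]) (use w(4-7) in \<open>auto intro!: carrier_matI\<close>)
  then show ?thesis by (intro det_similar) (auto simp: similar_mat_def)
qed

text \<open>Block LU factorization with pivot one.\<close>

lemma det_one_block:
  fixes G :: "real mat"
  assumes "r \<in> carrier_mat 1 k" "c \<in> carrier_mat k 1" "G \<in> carrier_mat k k"
  shows "det (four_block_mat (1\<^sub>m 1) r c G) = det (G - c * r)"
proof -
  have [simp]: "dim_row c = k" "dim_col c = 1" "dim_row r = 1" "dim_col r = k" "dim_row G = k" "dim_col G = k"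
    using assms by auto
  have schur: "G - c * r \<in> carrier_mat k k" by (rule carrier_matI) simp_all
  have "four_block_mat (1\<^sub>m 1) r c G
    = four_block_mat (1\<^sub>m 1) (0\<^sub>m 1 k) c (1\<^sub>m k) * four_block_mat (1\<^sub>m 1) r (0\<^sub>m k 1) (G - c * r)"
    by (auto simp: mat_dim_simps intro!: eq_matI simp del: index_mult_mat(1))
  also have "det \<dots> = det (four_block_mat (1\<^sub>m 1) (0\<^sub>m 1 k) c (1\<^sub>m k)) *
     det (four_block_mat (1\<^sub>m 1) r (0\<^sub>m k 1) (G - c * r))"
    by (rule det_mult[of _ "1 + k"]) (auto intro!: carrier_matI)
  also have "\<dots> = det (G - c * r)"
    unfolding det_four_block_mat_upper_right_zero[OF one_carrier_mat refl assms(2) one_carrier_mat]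
      det_four_block_mat_lower_left_zero[OF one_carrier_mat assms(1) refl schur] by simp
  finally show ?thesis .
qed

text \<open>The bound on the eigenvalues of \<open>Q\<close> is what the induction needs: the step puts the new
  eigenvalue \<open>Suc m\<close> on the diagonal, and being different from the old ones it can be split off.\<close>

lemma exists_similar_left_multiple:
  fixes G :: "real mat"
  assumes "G \<in> carrier_mat (Suc m) (Suc m)" "det G = 1"
    "m > 0 \<Longrightarrow> \<exists>v \<in> carrier_mat (Suc m) 1. \<forall>\<kappa>. G * v \<noteq> \<kappa> \<cdot>\<^sub>m v"
  shows "\<exists>Q \<in> carrier_mat (Suc m) (Suc m). det Q \<noteq> 0 \<and>
    (\<forall>\<mu> > real (Suc m). det (Q - \<mu> \<cdot>\<^sub>m 1\<^sub>m (Suc m)) \<noteq> 0) \<and> similar_mat (G * Q) Q"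
  using assms
proof (induction m arbitrary: G)
  case 0
  \<comment> \<open>In size one a matrix of determinant one is the identity, so \<open>Q\<close> can
    be the identity.\<close>
  then have "G $$ (0,0) = 1" by (simp add: det_single)
  then have G1: "G = 1\<^sub>m 1" using carrier_matD[OF 0(1)] by (intro eq_matI) simp_all
  show ?case
  proof (intro bexI conjI allI impI)
    show "det (1\<^sub>m (Suc 0) :: real mat) \<noteq> 0" by simp
    show "det (1\<^sub>m (Suc 0) - \<mu> \<cdot>\<^sub>m 1\<^sub>m (Suc 0)) \<noteq> 0" if "\<mu> > real (Suc 0)" for \<mu>
    proof -
      have "1\<^sub>m (Suc 0) - \<mu> \<cdot>\<^sub>m 1\<^sub>m (Suc 0) \<in> carrier_mat (Suc 0) (Suc 0)"
        by (rule carrier_matI) simp_all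
      then show ?thesis using that by (simp add: det_single)
    qed
    have "G * 1\<^sub>m (Suc 0) = 1\<^sub>m (Suc 0)" unfolding G1 by simp
    then show "similar_mat (G * 1\<^sub>m (Suc 0)) (1\<^sub>m (Suc 0))"
      using similar_mat_refl[of "1\<^sub>m (Suc 0) :: real mat" "Suc 0"] by simp
  qed simp
next
  case (Suc m)
  let ?k = "Suc m"
  obtain v where v: "v \<in> carrier_mat (1 + ?k) 1" "\<And>\<kappa>. G * v \<noteq> \<kappa> \<cdot>\<^sub>m v"
    using Suc.prems(3) by auto
  have G: "G \<in> carrier_mat (1 + ?k) (1 + ?k)" using Suc.prems(1) by simp
  obtain r0 c G0 where 0: "r0 \<in> carrier_mat 1 ?k" "c \<in> carrier_mat ?k 1" "G0 \<in> carrier_mat ?k ?k"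
    "similar_mat G (four_block_mat (1\<^sub>m 1) r0 c G0)" "c \<noteq> 0\<^sub>m ?k 1"
    using similar_mat_one_block[OF G v] .
  have d0: "det (G0 - c * r0) = 1"
    using det_one_block[OF 0(1-3)] det_similar[OF 0(4)] Suc.prems(2) by simp
  \<comment> \<open>The induction hypothesis asks for a nonscalar Schur complement unless its size
    is one, in which case the blocks are left as they are.\<close>
  obtain r H where H: "r \<in> carrier_mat 1 ?k" "H \<in> carrier_mat ?k ?k"
    "similar_mat G (four_block_mat (1\<^sub>m 1) r c H)"
    "m > 0 \<Longrightarrow> \<exists>v \<in> carrier_mat ?k 1. \<forall>\<kappa>. (H - c * r) * v \<noteq> \<kappa> \<cdot>\<^sub>m v"
  proof (cases "m = 0")
    case True
    then show thesis using 0 by (intro that[of r0 G0]) auto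
  next
    case False
    then have k2: "?k \<ge> 2" by simp
    have "det (G0 - c * r0) \<noteq> 0" using d0 by simp
    obtain r' G' where r': "r' \<in> carrier_mat 1 ?k" "G' \<in> carrier_mat ?k ?k"
      "similar_mat (four_block_mat (1\<^sub>m 1) r0 c G0) (four_block_mat (1\<^sub>m 1) r' c G')"
      "\<exists>v \<in> carrier_mat ?k 1. \<forall>\<kappa>. (G' - c * r') * v \<noteq> \<kappa> \<cdot>\<^sub>m v"
      using similar_one_block_nonscalar_schur[OF 0(1,2,5,3) k2 \<open>det (G0 - c * r0) \<noteq> 0\<close>] .
    show thesis
      by (rule that[OF r'(1,2) similar_mat_trans[OF 0(4) r'(3)] r'(4)])
  qed
  define S where "S = H - c * r"
  have [simp]: "dim_row r = 1" "dim_col r = ?k" "dim_row H = ?k" "dim_col H = ?k"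
    "dim_row c = ?k" "dim_col c = 1" "dim_row S = ?k" "dim_col S = ?k"
    using H 0 by (auto simp: S_def)
  have Sc: "S \<in> carrier_mat ?k ?k" by (rule carrier_matI) simp_all
  have detS: "det S = 1"
    using det_one_block[OF H(1) 0(2) H(2)] det_similar[OF H(3)] Suc.prems(2) by (simp add: S_def)
  obtain Q1 where Q1: "Q1 \<in> carrier_mat ?k ?k" "det Q1 \<noteq> 0"
    "\<And>\<mu>. \<mu> > real ?k \<Longrightarrow> det (Q1 - \<mu> \<cdot>\<^sub>m 1\<^sub>m ?k) \<noteq> 0" "similar_mat (S * Q1) Q1"
    using Suc.IH[OF Sc detS] H(4) unfolding S_def by blast
  have [simp]: "dim_row Q1 = ?k" "dim_col Q1 = ?k" using Q1 by auto
  define \<mu> where "\<mu> = real (Suc ?k)"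
  have SQ: "S * Q1 \<in> carrier_mat ?k ?k" by (rule carrier_matI) simp_all
  have dQ: "det (Q1 - \<mu> \<cdot>\<^sub>m 1\<^sub>m ?k) \<noteq> 0" using Q1(3)[of \<mu>] by (simp add: \<mu>_def)
  then have dSQ: "det (S * Q1 - \<mu> \<cdot>\<^sub>m 1\<^sub>m ?k) \<noteq> 0" using det_similar_minus_smult[OF Q1(4) SQ] by simp
  define F where "F = four_block_mat (1\<^sub>m 1) r c H"
  \<comment> \<open>The first row is chosen to cancel the upper right block of
    \<open>F * Q0\<close>, whose lower right block then becomes \<open>S * Q1\<close>.\<close>
  define Q0 where "Q0 = four_block_mat (\<mu> \<cdot>\<^sub>m 1\<^sub>m 1) (- (r * Q1)) (0\<^sub>m ?k 1) Q1"
  let ?Z = "four_block_mat (\<mu> \<cdot>\<^sub>m 1\<^sub>m 1) (0\<^sub>m 1 ?k) (0\<^sub>m ?k 1)"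
  have rQ: "- (r * Q1) \<in> carrier_mat 1 ?k" and mc: "\<mu> \<cdot>\<^sub>m c \<in> carrier_mat ?k 1"
    by (auto intro!: carrier_matI)
  have "- (c * (r * Q1)) + H * Q1 = S * Q1"
    unfolding S_def by (auto simp: mat_dim_simps intro!: eq_matI simp del: index_mult_mat(1))
  then have FQ: "F * Q0 = four_block_mat (\<mu> \<cdot>\<^sub>m 1\<^sub>m 1) (0\<^sub>m 1 ?k) (\<mu> \<cdot>\<^sub>m c) (S * Q1)"
    unfolding F_def Q0_def by (simp add: mat_dim_simps mat_smult_mult_dim)
  \<comment> \<open>Splitting off \<mu>, replacing \<open>S * Q1\<close> by the similar
    \<open>Q1\<close> and gluing \<mu> back leads from \<open>F * Q0\<close> to \<open>Q0\<close>.
    Both splittings rest on \<mu> exceeding the eigenvalue bound for \<open>Q1\<close>.\<close>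
  have Z1: "similar_mat (F * Q0) (?Z (S * Q1))"
    unfolding FQ by (rule similar_mat_lower_block[OF mc SQ dSQ])
  have Z2: "similar_mat (?Z (S * Q1)) (?Z Q1)"
    by (rule similar_mat_four_block_0_0[OF similar_mat_refl Q1(4) _ SQ]) auto
  have Z3: "similar_mat (?Z Q1) Q0"
    unfolding Q0_def by (rule similar_mat_sym[OF similar_mat_upper_block[OF rQ Q1(1) dQ]])
  have FQ_sim: "similar_mat (F * Q0) Q0"
    by (rule similar_mat_trans[OF similar_mat_trans[OF Z1 Z2] Z3])
  obtain P P' where PP: "similar_mat_wit G F P P'" using H(3) by (auto simp: similar_mat_def F_def)
  note P = similar_mat_witD2[OF Suc.prems(1) PP]
  have Q0c: "Q0 \<in> carrier_mat (Suc ?k) (Suc ?k)" unfolding Q0_def by (auto intro!: carrier_matI)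
  have [simp]: "dim_row P = Suc ?k" "dim_col P = Suc ?k" "dim_row P' = Suc ?k" "dim_col P' = Suc ?k"
    "dim_row F = Suc ?k" "dim_col F = Suc ?k" "dim_row Q0 = Suc ?k" "dim_col Q0 = Suc ?k"
    using P(5-7) Q0c by auto
  \<comment> \<open>The same conjugation takes \<open>F\<close> to \<open>G\<close> and
    \<open>Q0\<close> to \<open>Q\<close>, so the similarity is carried over.\<close>
  define Q where "Q = P * Q0 * P'"
  have Qc: "Q \<in> carrier_mat (Suc ?k) (Suc ?k)" by (rule carrier_matI) (simp_all add: Q_def)
  have QQ0: "similar_mat Q Q0"
    using similar_mat_witI[OF P(1,2) Q_def Qc Q0c P(6,7)] by (auto simp: similar_mat_def)
  have P'P: "P' * (P * X) = X" if "dim_row X = Suc ?k" for X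
    using that P(2) by (simp add: mat_assoc_dim[symmetric] mat_mult_one_dim)
  have GQ: "G * Q = P * (F * Q0) * P'"
    unfolding Q_def P(3) by (simp add: mat_assoc_dim P'P)
  have "similar_mat_wit (G * Q) (F * Q0) P P'"
    by (rule similar_mat_witI[OF P(1,2) GQ _ _ P(6,7)])
       (use Suc.prems(1) Qc in \<open>auto intro!: carrier_matI\<close>)
  then have "similar_mat (G * Q) (F * Q0)" by (auto simp: similar_mat_def)
  then have "similar_mat (G * Q) Q"
    by (rule similar_mat_trans[OF similar_mat_trans[OF _ FQ_sim] similar_mat_sym[OF QQ0]])
  moreover have "det Q \<noteq> 0"
  proof -
    have "det Q = det Q0" by (rule det_similar[OF QQ0])
    also have "\<dots> = \<mu> * det Q1"
      using det_four_block_mat_lower_left_zero[OF _ rQ refl Q1(1), of "\<mu> \<cdot>\<^sub>m 1\<^sub>m 1"]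
      by (simp add: Q0_def det_single)
    finally show ?thesis using Q1(2) by (simp add: \<mu>_def)
  qed
  moreover have "det (Q - \<nu> \<cdot>\<^sub>m 1\<^sub>m (Suc ?k)) \<noteq> 0" if \<nu>: "\<nu> > real (Suc ?k)" for \<nu>
  proof -
    have c: "(\<mu> - \<nu>) \<cdot>\<^sub>m 1\<^sub>m 1 \<in> carrier_mat 1 1" "Q1 - \<nu> \<cdot>\<^sub>m 1\<^sub>m ?k \<in> carrier_mat ?k ?k"
      by (auto intro!: carrier_matI)
    have "det (Q - \<nu> \<cdot>\<^sub>m 1\<^sub>m (Suc ?k)) = det (Q0 - \<nu> \<cdot>\<^sub>m 1\<^sub>m (Suc ?k))"
      by (rule det_similar_minus_smult[OF QQ0 Qc])
    also have "Q0 - \<nu> \<cdot>\<^sub>m 1\<^sub>m (Suc ?k) =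
      four_block_mat ((\<mu> - \<nu>) \<cdot>\<^sub>m 1\<^sub>m 1) (- (r * Q1)) (0\<^sub>m ?k 1) (Q1 - \<nu> \<cdot>\<^sub>m 1\<^sub>m ?k)"
      unfolding Q0_def by (rule eq_matI) (auto simp del: index_mult_mat(1))
    also have "det \<dots> = (\<mu> - \<nu>) * det (Q1 - \<nu> \<cdot>\<^sub>m 1\<^sub>m ?k)"
      using det_four_block_mat_lower_left_zero[OF c(1) rQ refl c(2)] by (simp add: det_single)
    finally show ?thesis using Q1(3)[of \<nu>] \<nu> by (simp add: \<mu>_def)
  qed
  ultimately show ?case using Qc by blast
qed

text \<open>One diagonal entry normalizes the determinant. Should every vector then be an
  eigenvector, a further nonscalar diagonal factor of determinant one destroys that.\<close>

lemma exists_pos_diagonal_nonscalar: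
  fixes K :: "real mat"
  assumes K: "K \<in> carrier_mat n n" and n: "n > 0" and det: "det K > 0"
  obtains D where "pos_diagonal n D" "det (K * D) = 1"
    "n > 1 \<Longrightarrow> \<exists>v \<in> carrier_mat n 1. \<forall>\<kappa>. (K * D) * v \<noteq> \<kappa> \<cdot>\<^sub>m v"
proof -
  define D where "D = multrow 0 (1 / det K) (1\<^sub>m n)"
  have D: "pos_diagonal n D" using det n by (auto simp: D_def pos_diagonal_def diagonal_mat_def)
  have Dc: "D \<in> carrier_mat n n" using pos_diagonal_carrier[OF D] .
  have "det D = 1 / det K" unfolding D_def using det_multrow[OF n, of "1\<^sub>m n" "1 / det K"] by simp
  then have KD: "det (K * D) = 1" using det det_mult[OF K Dc] by simp
  show thesis
  proof (cases "n > 1 \<longrightarrow> (\<exists>v \<in> carrier_mat n 1. \<forall>\<kappa>. (K * D) * v \<noteq> \<kappa> \<cdot>\<^sub>m v)")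
    case True
    then show thesis using that[OF D KD] by blast
  next
    case False
    then have n1: "n > 1" and scal: "\<And>v. v \<in> carrier_mat n 1 \<Longrightarrow> \<exists>\<kappa>. (K * D) * v = \<kappa> \<cdot>\<^sub>m v" by auto
    \<comment> \<open>The diagonal is 2, 1/2, 1, ..., which has determinant one and maps the
      all-ones column to a column that is not a multiple of it.\<close>
    define E where "E = multrow 0 2 (multrow 1 (1/2) (1\<^sub>m n :: real mat))"
    have E: "pos_diagonal n E" using n1 by (auto simp: E_def pos_diagonal_def diagonal_mat_def)
    have Ec: "E \<in> carrier_mat n n" using pos_diagonal_carrier[OF E] .
    have "det E = 1" unfolding E_def
      using det_multrow[OF n, of "multrow 1 (1/2) (1\<^sub>m n)" "2 :: real"]
        det_multrow[OF n1, of "1\<^sub>m n" "1/2 :: real"] by simp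
    then have KDE: "det (K * (D * E)) = 1"
      using KD K Dc Ec det_mult[of "K * D" n E] by (simp add: mat_assoc_dim)
    define v where "v = mat n 1 (\<lambda>_. 1 :: real)"
    define u where "u = mat n 1 (\<lambda>(i,_). if i = 0 then 2 else if i = 1 then 1/2 else 1 :: real)"
    have uv: "E * v = u"
    proof (rule eq_matI)
      fix i j assume "i < dim_row u" "j < dim_col u"
      then have i: "i < n" "j = 0" by (auto simp: u_def)
      have "(E * v) $$ (i,0) = (\<Sum>l<n. E $$ (i,l))"
        using i Ec by (simp add: v_def scalar_prod_def lessThan_atLeast0)
      also have "\<dots> = (\<Sum>l<n. if l = i then u $$ (i,0) else 0)"
        using i by (intro sum.cong) (auto simp: E_def u_def)
      finally show "(E * v) $$ (i,j) = u $$ (i,j)" using i by simp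
    qed (use Ec in \<open>auto simp: u_def v_def\<close>)
    obtain \<kappa> where \<kappa>: "K * D * u = \<kappa> \<cdot>\<^sub>m u" using scal[of u] by (auto simp: u_def)
    have "K * (D * E) * v \<noteq> l \<cdot>\<^sub>m v" for l
    proof
      assume eq: "K * (D * E) * v = l \<cdot>\<^sub>m v"
      have "K * (D * E) * v = K * D * u"
        using K Dc Ec by (simp add: uv[symmetric] mat_assoc_dim v_def)
      then have eq': "\<kappa> \<cdot>\<^sub>m u = l \<cdot>\<^sub>m v" using eq \<kappa> by simp
      \<comment> \<open>Entries 0 and 1 read \<open>2 * \<kappa> = l\<close> and
        \<open>\<kappa> / 2 = l\<close>.\<close>
      have "\<kappa> = 0"
        using arg_cong[OF eq', of "\<lambda>X. X $$ (0,0)"] arg_cong[OF eq', of "\<lambda>X. X $$ (1,0)"] n1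
        by (simp add: u_def v_def)
      obtain B where B: "B \<in> carrier_mat n n" "B * (K * D) = 1\<^sub>m n"
        using det_nonzero_inverse[of "K * D" n] KD K Dc by auto
      have "u = B * (K * D) * u" using B by (simp add: mat_mult_one_dim u_def)
      also have "\<dots> = B * (K * D * u)" using B(1) K Dc by (simp add: mat_assoc_dim u_def)
      also have "\<dots> = B * (0 \<cdot>\<^sub>m u)" unfolding \<kappa> \<open>\<kappa> = 0\<close> ..
      also have "\<dots> = 0 \<cdot>\<^sub>m (B * u)" using B(1) by (simp add: mat_smult_mult_dim u_def)
      finally have "u $$ (0,0) = (0 \<cdot>\<^sub>m (B * u)) $$ (0,0)" by simp
      also have "\<dots> = 0" using n B(1) by (simp add: u_def del: index_mult_mat(1))
      finally have "u $$ (0,0) = 0" .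
      then show False using n by (simp add: u_def)
    qed
    moreover have "v \<in> carrier_mat n 1" by (simp add: v_def)
    ultimately show thesis using that[OF pos_diagonal_mult[OF D E] KDE] by blast
  qed
qed

section \<open>Six layers suffice\<close>

text \<open>Induction on the number of columns. Adding a multiple of \<open>X\<close> makes the
  first column of \<open>Z\<close> nonzero; row and column operations then split off an entry one,
  and the trivial common kernel passes to the smaller pair.\<close>

lemma exists_det_nonzero_add_mult:
  fixes X Z :: "real mat"
  assumes "X \<in> carrier_mat m n" "Z \<in> carrier_mat n n"
    "\<And>v. v \<in> carrier_mat n 1 \<Longrightarrow> X * v = 0\<^sub>m m 1 \<Longrightarrow> Z * v = 0\<^sub>m n 1 \<Longrightarrow> v = 0\<^sub>m n 1"
  shows "\<exists>p \<in> carrier_mat n m. det (Z + p * X) \<noteq> 0"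
  using assms
proof (induction n arbitrary: X Z)
  case 0
  have "Z + 0\<^sub>m 0 m * X \<in> carrier_mat 0 0" using carrier_matD[OF 0(1)] by (intro carrier_matI) simp_all
  then have "det (Z + 0\<^sub>m 0 m * X) = 1" by (rule det_dim_zero)
  then show ?case by (intro bexI[of _ "0\<^sub>m 0 m"]) simp_all
next
  case (Suc n)
  define e :: "real mat" where "e = four_block_mat (1\<^sub>m 1) (0\<^sub>m 1 0) (0\<^sub>m n 1) (0\<^sub>m n 0)"
  have e: "e \<in> carrier_mat (1 + n) 1" by (rule carrier_matI) (simp_all add: e_def)
  have "e $$ (0,0) = 1" by (simp add: e_def)
  moreover have "(0\<^sub>m (1 + n) 1 :: real mat) $$ (0,0) = 0" by simp
  ultimately have e0: "e \<noteq> 0\<^sub>m (1 + n) 1" by (metis zero_neq_one)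
  have [simp]: "dim_row X = m" "dim_col X = Suc n" "dim_row Z = Suc n" "dim_col Z = Suc n"
    "dim_row e = Suc n" "dim_col e = 1"
    using carrier_matD[OF Suc.prems(1)] carrier_matD[OF Suc.prems(2)] carrier_matD[OF e] by simp_all
  \<comment> \<open>If \<open>Z\<close> kills the first unit vector \<open>e\<close>, then
    \<open>X\<close> does not, and \<open>p0 = e * w\<close> with \<open>w * (X * e) = 1\<close>
    gives \<open>(Z + p0 * X) * e = e\<close>.\<close>
  obtain p0 where p0: "p0 \<in> carrier_mat (1 + n) m" "(Z + p0 * X) * e \<noteq> 0\<^sub>m (1 + n) 1"
  proof (cases "Z * e = 0\<^sub>m (1 + n) 1")
    case False
    then show thesis by (intro that[of "0\<^sub>m (1 + n) m"]) (simp_all add: mat_dim_simps)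
  next
    case True
    have Xe: "X * e \<in> carrier_mat m 1" by (rule carrier_matI) simp_all
    have "X * e \<noteq> 0\<^sub>m m 1" using Suc.prems(3)[of e] True e e0 by auto
    then obtain w where w: "w \<in> carrier_mat 1 m" "w * (X * e) = 1\<^sub>m 1"
      using exists_left_inverse_column[OF Xe] by blast
    have "(Z + e * w * X) * e = e"
      using carrier_matD[OF w(1)] w(2) True by (simp add: mat_dim_simps)
    then show thesis using e0 carrier_matD[OF w(1)]
      by (intro that[of "e * w"] carrier_matI) simp_all
  qed
  define Z0 where "Z0 = Z + p0 * X"
  have [simp]: "dim_row p0 = Suc n" "dim_col p0 = m" "dim_row Z0 = Suc n" "dim_col Z0 = Suc n"
    using carrier_matD[OF p0(1)] by (simp_all add: Z0_def)
  have Z0e: "Z0 * e \<in> carrier_mat (1 + n) 1" "Z0 * e \<noteq> 0\<^sub>m (1 + n) 1"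
    using p0(2) by (simp_all add: Z0_def carrier_matI)
  obtain g h where gh: "g \<in> carrier_mat (1 + n) (1 + n)" "h \<in> carrier_mat (1 + n) (1 + n)"
    "g * h = 1\<^sub>m (1 + n)" "h * g = 1\<^sub>m (1 + n)" "g * e = Z0 * e" "h * (Z0 * e) = e"
    using exists_invertible_mapping_column[OF e e0 Z0e] .
  have [simp]: "dim_row g = Suc n" "dim_col g = Suc n" "dim_row h = Suc n" "dim_col h = Suc n"
    using carrier_matD[OF gh(1)] carrier_matD[OF gh(2)] by simp_all
  obtain a r c Z1 where split: "split_block (h * Z0) 1 1 = (a, r, c, Z1)" by (metis prod_cases4)
  have blk: "a \<in> carrier_mat 1 1" "r \<in> carrier_mat 1 n" "c \<in> carrier_mat n 1" "Z1 \<in> carrier_mat n n"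
    and hZ: "h * Z0 = four_block_mat a r c Z1"
    using split_block[OF split, of n n] by simp_all
  \<comment> \<open>Lower blocks of height zero turn \<open>X\<close> into a two by two block matrix
    that fits the block product law.\<close>
  obtain x X1 x' X1' where splitX: "split_block X m 1 = (x, X1, x', X1')" by (metis prod_cases4)
  have blkX: "x \<in> carrier_mat m 1" "X1 \<in> carrier_mat m n" "x' \<in> carrier_mat 0 1" "X1' \<in> carrier_mat 0 n"
    and X: "X = four_block_mat x X1 x' X1'"
    using split_block[OF splitX, of 0 n] by simp_all
  have [simp]: "dim_row a = 1" "dim_col a = 1" "dim_row r = 1" "dim_col r = n" "dim_row c = n"
    "dim_col c = 1" "dim_row Z1 = n" "dim_col Z1 = n" "dim_row x = m" "dim_col x = 1"
    "dim_row X1 = m" "dim_col X1 = n" "dim_row x' = 0" "dim_col x' = 1" "dim_row X1' = 0" "dim_col X1' = n"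
    using blk blkX by simp_all
  have "four_block_mat a (0\<^sub>m 1 0) c (0\<^sub>m n 0) = h * Z0 * e"
    unfolding hZ e_def by (simp add: mat_dim_simps)
  also have "\<dots> = four_block_mat (1\<^sub>m 1) (0\<^sub>m 1 0) (0\<^sub>m n 1) (0\<^sub>m n 0)"
    unfolding e_def[symmetric] using gh(6) by (simp add: mat_assoc_dim)
  finally have e_eq: "four_block_mat a (0\<^sub>m 1 0) c (0\<^sub>m n 0) =
    four_block_mat (1\<^sub>m 1) (0\<^sub>m 1 0) (0\<^sub>m n 1) (0\<^sub>m n 0)" .
  have a: "a = 1\<^sub>m 1" and c: "c = 0\<^sub>m n 1"
    using four_block_mat_inject(1,3)[OF e_eq, where n=1 and k=1 and l=0 and m=n]
    by (simp_all add: carrier_matI)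
  \<comment> \<open>\<open>h\<close> has already brought the first column to \<open>e\<close>; the
    column operation \<open>?U\<close> clears the rest of the first row.\<close>
  let ?U = "four_block_mat (1\<^sub>m 1) (- r) (0\<^sub>m n 1) (1\<^sub>m n)"
  define X2 where "X2 = - (x * r) + X1"
  have [simp]: "dim_row X2 = m" "dim_col X2 = n" by (simp_all add: X2_def)
  have X2c: "X2 \<in> carrier_mat m n" by (rule carrier_matI) simp_all
  have hZU: "h * Z0 * ?U = four_block_mat (1\<^sub>m 1) (0\<^sub>m 1 n) (0\<^sub>m n 1) Z1"
    unfolding hZ a c by (simp add: mat_dim_simps)
  have zero_rows: "A = 0\<^sub>m 0 k" if "dim_row A = 0" "dim_col A = k" for A :: "real mat" and k
    using that by (intro eq_matI) simp_all
  have x': "x' = 0\<^sub>m 0 1" and X1': "X1' = 0\<^sub>m 0 n" by (rule zero_rows; simp)+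
  have XU: "X * ?U = four_block_mat x X2 (0\<^sub>m 0 1) (0\<^sub>m 0 n)"
    unfolding X x' X1' X2_def by (simp add: mat_dim_simps)
  have "\<exists>p \<in> carrier_mat n m. det (Z1 + p * X2) \<noteq> 0"
  proof (rule Suc.IH[OF X2c blk(4)])
    fix v assume v: "v \<in> carrier_mat n 1" "X2 * v = 0\<^sub>m m 1" "Z1 * v = 0\<^sub>m n 1"
    \<comment> \<open>Extended by zero and moved by \<open>?U\<close>, a common kernel vector of the
      smaller pair lies in the kernels of \<open>X\<close> and \<open>Z0\<close>, hence in that of
      \<open>Z\<close>.\<close>
    let ?v = "four_block_mat (0\<^sub>m 1 1) (0\<^sub>m 1 0) v (0\<^sub>m n 0)"
    have [simp]: "dim_row v = n" "dim_col v = 1" using v(1) by simp_all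
    have Uv: "?U * ?v \<in> carrier_mat (Suc n) 1" by (rule carrier_matI) simp_all
    have "X * (?U * ?v) = X * ?U * ?v" by (rule mat_assoc_dim[symmetric]) simp_all
    also have "\<dots> = 0\<^sub>m m 1" unfolding XU by (simp add: mat_dim_simps v)
    finally have Xv: "X * (?U * ?v) = 0\<^sub>m m 1" .
    have "Z0 * (?U * ?v) = g * (h * Z0 * ?U * ?v)"
      using gh(3) by (simp add: mat_assoc_dim[symmetric] mat_mult_one_dim del: assoc_mult_mat)
    also have "h * Z0 * ?U * ?v = 0\<^sub>m (1 + n) 1" unfolding hZU by (simp add: mat_dim_simps v)
    finally have "Z0 * (?U * ?v) = 0\<^sub>m (Suc n) 1" by (simp add: mat_mult_zero_dim)
    moreover have "Z0 * (?U * ?v) = Z * (?U * ?v) + p0 * (X * (?U * ?v))"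
      unfolding Z0_def using Uv by (simp add: mat_add_mult_dim mat_assoc_dim)
    ultimately have "Z * (?U * ?v) = 0\<^sub>m (Suc n) 1"
      unfolding Xv by (simp add: mat_mult_zero_dim mat_add_zero_dim)
    from Suc.prems(3)[OF Uv Xv this] have "?U * ?v = 0\<^sub>m (Suc n) 1" .
    moreover have "?U * ?v = four_block_mat (- (r * v)) (0\<^sub>m 1 0) v (0\<^sub>m n 0)" by (simp add: mat_dim_simps)
    moreover have "0\<^sub>m (Suc n) 1 = (four_block_mat (0\<^sub>m 1 1) (0\<^sub>m 1 0) (0\<^sub>m n 1) (0\<^sub>m n 0) :: real mat)"
      by simp
    ultimately have "four_block_mat (- (r * v)) (0\<^sub>m 1 0) v (0\<^sub>m n 0) =
       four_block_mat (0\<^sub>m 1 1) (0\<^sub>m 1 0) (0\<^sub>m n 1) (0\<^sub>m n 0)" by metis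
    then show "v = 0\<^sub>m n 1"
      by (rule four_block_mat_inject(3)[where n=1 and k=1 and l=0 and m=n]; simp add: v carrier_matI)
  qed
  then obtain p1 where p1: "p1 \<in> carrier_mat n m" "det (Z1 + p1 * X2) \<noteq> 0" by blast
  \<comment> \<open>The zero first row preserves the first row of \<open>h * Z0 * ?U\<close>, so the
    result is block triangular with diagonal blocks \<open>1\<close> and
    \<open>Z1 + p1 * X2\<close>.\<close>
  define p2 where "p2 = four_block_mat (0\<^sub>m 1 m) (0\<^sub>m 1 0) p1 (0\<^sub>m n 0)"
  define p where "p = p0 + g * p2"
  have [simp]: "dim_row p1 = n" "dim_col p1 = m" "dim_row p2 = Suc n" "dim_col p2 = m"
     "dim_row p = Suc n" "dim_col p = m"
    using p1(1) by (simp_all add: p2_def p_def)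
  have pc: "p \<in> carrier_mat (Suc n) m" by (rule carrier_matI) simp_all
  have "h * (Z + p * X) * ?U = h * Z0 * ?U + p2 * (X * ?U)"
  proof -
    have "h * (Z + p * X) = h * Z0 + h * (g * (p2 * X))"
      unfolding p_def Z0_def by (simp add: mat_dim_simps)
    also have "h * (g * (p2 * X)) = p2 * X"
      using gh(4) by (simp add: mat_assoc_dim[symmetric] mat_mult_one_dim del: assoc_mult_mat)
    finally show ?thesis by (simp add: mat_add_mult_dim mat_assoc_dim)
  qed
  also have "\<dots> = four_block_mat (1\<^sub>m 1) (0\<^sub>m 1 n) (p1 * x) (Z1 + p1 * X2)"
    unfolding hZU XU p2_def
    by (subst mat_mult_four_block_dim, simp_all, subst add_four_block_mat[of _ 1 1 _ n _ n])
       (simp_all add: mat_dim_simps carrier_matI)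
  finally have eq: "h * (Z + p * X) * ?U = \<dots>" .
  have "det (h * (Z + p * X) * ?U) = det (Z1 + p1 * X2)"
  proof -
    have c: "p1 * x \<in> carrier_mat n 1" "Z1 + p1 * X2 \<in> carrier_mat n n"
      by (rule carrier_matI; simp)+
    show ?thesis unfolding eq det_four_block_mat_upper_right_zero[OF one_carrier_mat refl c] by simp
  qed
  moreover have "det (h * (Z + p * X) * ?U) = det h * det (Z + p * X) * det ?U"
  proof -
    have c: "h \<in> carrier_mat (Suc n) (Suc n)" "Z + p * X \<in> carrier_mat (Suc n) (Suc n)"
      "h * (Z + p * X) \<in> carrier_mat (Suc n) (Suc n)" "?U \<in> carrier_mat (Suc n) (Suc n)"
      by (rule carrier_matI; simp)+
    show ?thesis unfolding det_mult[OF c(3,4)] det_mult[OF c(1,2)] ..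
  qed
  ultimately have "det (Z + p * X) \<noteq> 0" using p1(2) by auto
  then show ?case using pc by blast
qed

text \<open>With \<open>b = P Q - P\<close> one has \<open>P' b = Q - 1\<close> and \<open>b P' = \<Delta> - 1\<close>, so the product of the two inner
  factors has lower right block \<open>\<Delta>\<close> with Schur complement \<open>Q'\<close>; the outer factors adjust the
  off-diagonal blocks.\<close>

lemma block_eq_four_unipotents:
  fixes \<Delta> :: "real mat"
  assumes "S \<in> carrier_mat n n" "Z \<in> carrier_mat n n"
    and P: "P \<in> carrier_mat n n" "P' \<in> carrier_mat n n" "P * P' = 1\<^sub>m n" "P' * P = 1\<^sub>m n"
    and Q: "Q \<in> carrier_mat n n" "Q' \<in> carrier_mat n n" "Q * Q' = 1\<^sub>m n" "Q' * Q = 1\<^sub>m n"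
    and \<Delta>: "\<Delta> = P * Q * P'"
  defines "\<Delta>' \<equiv> P * Q' * P'"
  shows "four_block_mat (Q' + S * \<Delta>' * Z) S Z \<Delta> =
    four_block_mat (1\<^sub>m n) (S * \<Delta>' - P' * \<Delta>') (0\<^sub>m n n) (1\<^sub>m n) *
    (four_block_mat (1\<^sub>m n) (0\<^sub>m n n) (P * Q - P) (1\<^sub>m n) *
    (four_block_mat (1\<^sub>m n) P' (0\<^sub>m n n) (1\<^sub>m n) *
     four_block_mat (1\<^sub>m n) (0\<^sub>m n n) (\<Delta>' * Z - \<Delta>' * (P * Q - P)) (1\<^sub>m n)))"
proof -
  have [simp]: "dim_row S = n" "dim_col S = n" "dim_row Z = n" "dim_col Z = n"
    "dim_row P = n" "dim_col P = n" "dim_row P' = n" "dim_col P' = n"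
    "dim_row Q = n" "dim_col Q = n" "dim_row Q' = n" "dim_col Q' = n"
    "dim_row \<Delta> = n" "dim_col \<Delta> = n" "dim_row \<Delta>' = n" "dim_col \<Delta>' = n"
    using assms(1-2) P Q \<Delta> by (simp_all add: \<Delta>'_def)
  define b where "b = P * Q - P"
  have [simp]: "dim_row b = n" "dim_col b = n" by (simp_all add: b_def)
  have cancel: "A * (B * C) = C" if "A * B = 1\<^sub>m n" "dim_col A = dim_row B" "dim_col B = n" "dim_row C = n"
    for A B C :: "real mat"
    using that by (simp add: mat_assoc_dim[symmetric] mat_mult_one_dim del: assoc_mult_mat)
  note PQ = cancel[OF P(3)] cancel[OF P(4)] cancel[OF Q(3)] cancel[OF Q(4)]
  have bP: "b * P' + 1\<^sub>m n = \<Delta>"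
    unfolding b_def \<Delta> by (simp add: mat_dim_simps P)
      (auto intro!: eq_matI simp del: index_mult_mat(1))
  have \<Delta>\<Delta>': "\<Delta> * \<Delta>' = 1\<^sub>m n" "\<Delta>' * \<Delta> = 1\<^sub>m n"
    unfolding \<Delta> \<Delta>'_def by (simp_all add: mat_assoc_dim PQ P)
  note \<Delta>c = cancel[OF \<Delta>\<Delta>'(1)] cancel[OF \<Delta>\<Delta>'(2)]
  \<comment> \<open>This turns the upper left block of the product of the last three factors into
    \<open>Q' + P' * (\<Delta>' * Z)\<close>.\<close>
  have Pb: "P' * (\<Delta>' * b) = 1\<^sub>m n - Q'"
    unfolding \<Delta>'_def b_def by (simp add: mat_mult_minus_dim mat_assoc_dim PQ P Q)
  have "four_block_mat (1\<^sub>m n) P' (0\<^sub>m n n) (1\<^sub>m n) *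
     four_block_mat (1\<^sub>m n) (0\<^sub>m n n) (\<Delta>' * Z - \<Delta>' * b) (1\<^sub>m n) =
     four_block_mat (1\<^sub>m n + P' * (\<Delta>' * Z - \<Delta>' * b)) P' (\<Delta>' * Z - \<Delta>' * b) (1\<^sub>m n)"
    by (simp add: mat_mult_four_block_dim mat_mult_one_dim mat_mult_zero_dim mat_add_zero_dim)
  also have "four_block_mat (1\<^sub>m n) (0\<^sub>m n n) b (1\<^sub>m n) * \<dots> =
     four_block_mat (1\<^sub>m n + P' * (\<Delta>' * Z - \<Delta>' * b)) P' (b * (1\<^sub>m n + P' * (\<Delta>' * Z - \<Delta>' * b)) + (\<Delta>' * Z - \<Delta>' * b)) (b * P' + 1\<^sub>m n)"
    by (simp add: mat_mult_four_block_dim mat_mult_one_dim mat_mult_zero_dim mat_add_zero_dim)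
  also have "b * (1\<^sub>m n + P' * (\<Delta>' * Z - \<Delta>' * b)) + (\<Delta>' * Z - \<Delta>' * b) =
     b + (b * P' + 1\<^sub>m n) * (\<Delta>' * Z - \<Delta>' * b)"
    by (simp add: mat_add_mult_dim mat_mult_add_dim mat_assoc_dim mat_mult_one_dim mat_add_assoc_dim)
  also have "\<dots> = b + (Z - b)" unfolding bP by (simp add: mat_mult_minus_dim \<Delta>c)
  also have "\<dots> = Z" by (rule eq_matI) auto
  also have "b * P' + 1\<^sub>m n = \<Delta>" by (rule bP)
  also have "P' * (\<Delta>' * Z - \<Delta>' * b) = P' * (\<Delta>' * Z) - (1\<^sub>m n - Q')"
    by (simp add: mat_mult_minus_dim Pb)
  also have "1\<^sub>m n + (P' * (\<Delta>' * Z) - (1\<^sub>m n - Q')) = Q' + P' * (\<Delta>' * Z)"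
    by (rule eq_matI) (auto simp del: index_mult_mat(1))
  also have "four_block_mat (1\<^sub>m n) (S * \<Delta>' - P' * \<Delta>') (0\<^sub>m n n) (1\<^sub>m n) *
      four_block_mat (Q' + P' * (\<Delta>' * Z)) P' Z \<Delta> =
    four_block_mat (Q' + P' * (\<Delta>' * Z) + (S * \<Delta>' - P' * \<Delta>') * Z) (P' + (S * \<Delta>' - P' * \<Delta>') * \<Delta>) Z \<Delta>"
    by (simp add: mat_mult_four_block_dim mat_mult_one_dim mat_mult_zero_dim mat_add_zero_dim)
  also have "P' + (S * \<Delta>' - P' * \<Delta>') * \<Delta> = P' + (S - P')"
    by (simp add: mat_minus_mult_dim mat_assoc_dim \<Delta>\<Delta>' mat_mult_one_dim)
  also have "\<dots> = S" by (rule eq_matI) auto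
  also have "Q' + P' * (\<Delta>' * Z) + (S * \<Delta>' - P' * \<Delta>') * Z = Q' + S * \<Delta>' * Z"
    by (simp add: mat_minus_mult_dim mat_assoc_dim)
      (rule eq_matI, auto simp del: index_mult_mat(1))
  finally show ?thesis by (simp add: b_def)
qed

lemma six_layers_sufficient:
  assumes n: "n \<ge> 1" and M: "M \<in> GL (2 * n)" and det: "det M > 0"
  shows "represented_by_depth n 6 M"
proof -
  have Mc: "M \<in> carrier_mat (n + n) (n + n)" using M by (simp add: GL_def mult_2)
  obtain X Y Z W where split: "split_block M n n = (X, Y, Z, W)" by (metis prod_cases4)
  have XYZW: "X \<in> carrier_mat n n" "Y \<in> carrier_mat n n" "Z \<in> carrier_mat n n" "W \<in> carrier_mat n n"
    and MB: "M = four_block_mat X Y Z W"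
    using split_block[OF split, of n n] Mc by auto
  have [simp]: "dim_row X = n" "dim_col X = n" "dim_row Y = n" "dim_col Y = n"
    "dim_row Z = n" "dim_col Z = n" "dim_row W = n" "dim_col W = n" using XYZW by simp_all
  have cancel: "A * (B * C) = C" if "A * B = 1\<^sub>m n" "dim_col A = dim_row B" "dim_col B = n" "dim_row C = n"
    for A B C :: "real mat"
    using that by (simp add: mat_assoc_dim[symmetric] mat_mult_one_dim del: assoc_mult_mat)
  have "det M \<noteq> 0" using det by simp
  then obtain N where N: "N \<in> carrier_mat (n + n) (n + n)" "N * M = 1\<^sub>m (n + n)"
    using det_nonzero_inverse[OF Mc] by blast
  \<comment> \<open>The left half of the columns of an invertible matrix has trivial kernel: pad
    \<open>v\<close> with zeros and apply the inverse \<open>N\<close>.\<close>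
  have "\<exists>p \<in> carrier_mat n n. det (Z + p * X) \<noteq> 0"
  proof (rule exists_det_nonzero_add_mult[OF XYZW(1,3)])
    fix v assume v: "v \<in> carrier_mat n 1" "X * v = 0\<^sub>m n 1" "Z * v = 0\<^sub>m n 1"
    let ?v = "four_block_mat v (0\<^sub>m n 0) (0\<^sub>m n 1) (0\<^sub>m n 0)"
    have [simp]: "dim_row v = n" "dim_col v = 1" using v(1) by simp_all
    have "?v = N * M * ?v" using N(2) by (simp add: mat_mult_one_dim)
    also have "\<dots> = N * (M * ?v)" using carrier_matD[OF N(1)] carrier_matD[OF Mc] by (simp add: mat_assoc_dim)
    also have "M * ?v = 0\<^sub>m (n + n) 1" unfolding MB by (simp add: mat_dim_simps v)
    also have "N * \<dots> = 0\<^sub>m (n + n) 1" using carrier_matD[OF N(1)] by (simp add: mat_mult_zero_dim)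
    also have "\<dots> = four_block_mat (0\<^sub>m n 1) (0\<^sub>m n 0) (0\<^sub>m n 1) (0\<^sub>m n 0)" by (rule eq_matI) auto
    finally show "v = 0\<^sub>m n 1"
      by (rule four_block_mat_inject(1)[where n=n and k=1 and l=0 and m=n]; simp add: carrier_matI)
  qed
  then obtain p where p: "p \<in> carrier_mat n n" "det (Z + p * X) \<noteq> 0" by blast
  have [simp]: "dim_row p = n" "dim_col p = n" using p by simp_all
  define Z1 where "Z1 = Z + p * X"
  define W1 where "W1 = W + p * Y"
  have [simp]: "dim_row Z1 = n" "dim_col Z1 = n" "dim_row W1 = n" "dim_col W1 = n"
    by (simp_all add: Z1_def W1_def)
  have Z1c: "Z1 \<in> carrier_mat n n" by (rule carrier_matI) simp_all
  have "det Z1 \<noteq> 0" using p by (simp add: Z1_def)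
  then obtain Zi where Zi: "Zi \<in> carrier_mat n n" "Z1 * Zi = 1\<^sub>m n" "Zi * Z1 = 1\<^sub>m n"
    using det_nonzero_inverse[OF Z1c] by blast
  have [simp]: "dim_row Zi = n" "dim_col Zi = n" using Zi by simp_all
  note Zc = cancel[OF Zi(2)] cancel[OF Zi(3)]
  \<comment> \<open>Right multiplication by the upper unipotent matrix with block
    \<open>- (Zi * W1)\<close> clears the lower right block and leaves \<open>Y1\<close> above
    it.\<close>
  define Y1 where "Y1 = Y - X * (Zi * W1)"
  have [simp]: "dim_row Y1 = n" "dim_col Y1 = n" by (simp_all add: Y1_def)
  have Y1c: "Y1 \<in> carrier_mat n n" by (rule carrier_matI) simp_all
  let ?U = "\<lambda>A. four_block_mat (1\<^sub>m n) A (0\<^sub>m n n) (1\<^sub>m n)"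
  let ?L = "\<lambda>A. four_block_mat (1\<^sub>m n) (0\<^sub>m n n) A (1\<^sub>m n)"
  define B where "B = four_block_mat X Y1 Z1 (0\<^sub>m n n)"
  have Y_eq: "X * (Zi * W1) + Y1 = Y"
    unfolding Y1_def by (rule eq_matI) (auto simp del: index_mult_mat(1))
  have Z_eq: "- (p * X) + Z1 = Z" "- (p * Y) + W1 = W"
    unfolding Z1_def W1_def by (rule eq_matI; auto simp del: index_mult_mat(1))+
  have M_B: "M = ?L (- p) * (B * ?U (Zi * W1))"
    unfolding B_def MB by (simp add: mat_dim_simps Zc Y_eq Z_eq)
  define K where "K = - (Y1 * Z1)"
  have [simp]: "dim_row K = n" "dim_col K = n" by (simp_all add: K_def)
  have Kc: "K \<in> carrier_mat n n" by (rule carrier_matI) simp_all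
  \<comment> \<open>Chosen so that \<open>B * ?U Zi\<close> is \<open>?U s\<close> times a lower
    block triangular matrix with \<open>K\<close> on its diagonal; this gives
    \<open>det B = det K\<close> without tracking the sign of a block swap.\<close>
  define s where "s = X * Zi + Y1"
  have [simp]: "dim_row s = n" "dim_col s = n" by (simp_all add: s_def)
  have unip: "?L A \<in> carrier_mat (n + n) (n + n)" "?U A \<in> carrier_mat (n + n) (n + n)"
    "det (?L A) = 1" "det (?U A) = 1" if "dim_row A = n" "dim_col A = n" for A :: "real mat"
  proof -
    have Ac: "A \<in> carrier_mat n n" using that by (rule carrier_matI)
    show "?L A \<in> carrier_mat (n + n) (n + n)" "?U A \<in> carrier_mat (n + n) (n + n)" by (rule carrier_matI; simp)+
    show "det (?L A) = 1"
      unfolding det_four_block_mat_upper_right_zero[OF one_carrier_mat refl Ac one_carrier_mat] by simp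
    show "det (?U A) = 1"
      unfolding det_four_block_mat_lower_left_zero[OF one_carrier_mat Ac refl one_carrier_mat] by simp
  qed
  have Bc: "B \<in> carrier_mat (n + n) (n + n)" unfolding B_def by (rule carrier_matI) simp_all
  have "det M = det B"
  proof -
    have c: "B * ?U (Zi * W1) \<in> carrier_mat (n + n) (n + n)" using carrier_matD[OF Bc] by (intro carrier_matI) simp_all
    have "det M = det (?L (- p)) * (det B * det (?U (Zi * W1)))"
      unfolding M_B det_mult[OF unip(1) c, of "- p", simplified] by (subst det_mult[OF Bc unip(2)]) simp_all
    then show ?thesis by (simp add: unip(3,4))
  qed
  also have "\<dots> = det K"
  proof -
    have "K + s * Z1 = X"
      unfolding K_def s_def by (simp add: mat_dim_simps Zi) (rule eq_matI; auto simp del: index_mult_mat(1))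
    then have eq: "B * ?U Zi = ?U s * four_block_mat K (0\<^sub>m n n) Z1 (1\<^sub>m n)"
      unfolding B_def by (simp add: mat_dim_simps Zi s_def)
    have c: "four_block_mat K (0\<^sub>m n n) Z1 (1\<^sub>m n) \<in> carrier_mat (n + n) (n + n)" by (rule carrier_matI) simp_all
    have "det B * det (?U Zi) = det (?U s) * det (four_block_mat K (0\<^sub>m n n) Z1 (1\<^sub>m n))"
      using det_mult[OF Bc unip(2), of Zi] det_mult[OF unip(2) c, of s] eq by simp
    also have "det (four_block_mat K (0\<^sub>m n n) Z1 (1\<^sub>m n)) = det K"
      unfolding det_four_block_mat_upper_right_zero[OF Kc refl Z1c one_carrier_mat] by simp
    finally show ?thesis by (simp add: unip(4))
  qed
  finally have detK: "det K > 0" using det by simp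
  have "det Y1 \<noteq> 0"
  proof -
    have c: "- Z1 \<in> carrier_mat n n" by (rule carrier_matI) simp_all
    have "K = Y1 * - Z1" by (simp add: K_def)
    then have "det K = det Y1 * det (- Z1)" using det_mult[OF Y1c c] by simp
    then show ?thesis using detK by auto
  qed
  then obtain Yi where Yi: "Yi \<in> carrier_mat n n" "Y1 * Yi = 1\<^sub>m n" "Yi * Y1 = 1\<^sub>m n"
    using det_nonzero_inverse[OF Y1c] by blast
  have n0: "n > 0" using n by simp
  obtain D where D: "pos_diagonal n D" "det (K * D) = 1"
    "n > 1 \<Longrightarrow> \<exists>v \<in> carrier_mat n 1. \<forall>\<kappa>. (K * D) * v \<noteq> \<kappa> \<cdot>\<^sub>m v"
    using exists_pos_diagonal_nonscalar[OF Kc n0 detK] by blast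
  obtain E where E: "pos_diagonal n E" "D * E = 1\<^sub>m n" "E * D = 1\<^sub>m n"
    using pos_diagonal_inverse[OF D(1)] .
  have [simp]: "dim_row Yi = n" "dim_col Yi = n" "dim_row D = n" "dim_col D = n" "dim_row E = n" "dim_col E = n"
    using Yi pos_diagonal_carrier[OF D(1)] pos_diagonal_carrier[OF E(1)] by simp_all
  have KDc: "K * D \<in> carrier_mat n n" by (rule carrier_matI) simp_all
  obtain m where m: "n = Suc m" using n0 gr0_conv_Suc by blast
  obtain Q where Q: "Q \<in> carrier_mat n n" "det Q \<noteq> 0" "similar_mat (K * D * Q) Q"
    using exists_similar_left_multiple[of "K * D" m, folded m] KDc D(2,3) m by auto
  obtain Q' where Q': "Q' \<in> carrier_mat n n" "Q * Q' = 1\<^sub>m n" "Q' * Q = 1\<^sub>m n"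
    using det_nonzero_inverse[OF Q(1,2)] .
  have [simp]: "dim_row Q = n" "dim_col Q = n" "dim_row Q' = n" "dim_col Q' = n" using Q Q' by simp_all
  have KDQc: "K * D * Q \<in> carrier_mat n n" by (rule carrier_matI) simp_all
  obtain R R' where wit: "similar_mat_wit (K * D * Q) Q R R'" using Q(3) by (auto simp: similar_mat_def)
  note R = similar_mat_witD2[OF KDQc wit]
  have [simp]: "dim_row R = n" "dim_col R = n" "dim_row R' = n" "dim_col R' = n" using R by simp_all
  note cs = cancel[OF Q'(2)] cancel[OF Q'(3)] cancel[OF Yi(2)] cancel[OF Yi(3)] cancel[OF R(1)] cancel[OF R(2)]
    cancel[OF E(2)] cancel[OF E(3)] Zc
  \<comment> \<open>Since \<open>K * D * Q = R * Q * R'\<close> and \<open>Yi * K = - Z1\<close>,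
    conjugating \<open>Q\<close> by \<open>P\<close> gives the block
    \<open>- (Z1 * (D * (Q * Y1)))\<close>.\<close>
  define P where "P = Yi * R"
  define P' where "P' = R' * Y1"
  have [simp]: "dim_row P = n" "dim_col P = n" "dim_row P' = n" "dim_col P' = n" by (simp_all add: P_def P'_def)
  have Pc: "P \<in> carrier_mat n n" "P' \<in> carrier_mat n n" by (rule carrier_matI; simp)+
  have PP': "P * P' = 1\<^sub>m n" "P' * P = 1\<^sub>m n"
    unfolding P_def P'_def by (simp_all add: mat_assoc_dim cs Yi R)
  define \<Delta> where "\<Delta> = P * Q * P'"
  define \<Delta>' where "\<Delta>' = P * Q' * P'"
  have [simp]: "dim_row \<Delta> = n" "dim_col \<Delta> = n" "dim_row \<Delta>' = n" "dim_col \<Delta>' = n"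
    by (simp_all add: \<Delta>_def \<Delta>'_def)
  have "\<Delta> = Yi * (R * Q * R') * Y1" unfolding \<Delta>_def P_def P'_def by (simp add: mat_assoc_dim)
  also have "\<dots> = Yi * (K * D * Q) * Y1" using R(3) by simp
  also have "\<dots> = - (Z1 * (D * (Q * Y1)))" unfolding K_def by (simp add: mat_assoc_dim cs)
  finally have \<Delta>_eq: "\<Delta> = - (Z1 * (D * (Q * Y1)))" .
  have \<Delta>\<Delta>: "\<Delta>' * \<Delta> = 1\<^sub>m n" unfolding \<Delta>_def \<Delta>'_def
    by (simp add: mat_assoc_dim cs cancel[OF PP'(1)] cancel[OF PP'(2)] PP')
  have \<Delta>'_Z: "\<Delta>' * (Z1 * D) = - (Yi * Q')"
  proof -
    have "\<Delta>' * (Z1 * D) = \<Delta>' * (Z1 * (D * (Q * Y1))) * (Yi * Q')" by (simp add: mat_assoc_dim cs Q' mat_mult_one_dim)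
    also have "Z1 * (D * (Q * Y1)) = - \<Delta>" unfolding \<Delta>_eq by simp
    finally show ?thesis by (simp add: \<Delta>\<Delta> mat_mult_one_dim)
  qed
  \<comment> \<open>\<open>S\<close> and \<Delta> form the right block column of \<open>B\<close>
    after the left one has been scaled by \<open>D\<close>, multiplied by \<open>Q * Y1\<close> and
    subtracted.\<close>
  define S where "S = Y1 - X * (D * (Q * Y1))"
  have [simp]: "dim_row S = n" "dim_col S = n" by (simp_all add: S_def)
  \<comment> \<open>Hence the Schur complement of \<Delta> is \<open>Q'\<close>, the form that
    \<open>block_eq_four_unipotents\<close> produces.\<close>
  have "Q' + S * \<Delta>' * (Z1 * D) = X * D"
    by (simp add: mat_assoc_dim \<Delta>'_Z)
       (simp add: S_def mat_minus_mult_dim mat_assoc_dim cs Q' mat_mult_one_dim,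
        rule eq_matI; auto simp del: index_mult_mat(1))
  note four = this
  define a where "a = S * \<Delta>' - P' * \<Delta>'"
  define b where "b = P * Q - P"
  define d where "d = \<Delta>' * (Z1 * D) - \<Delta>' * b"
  have Sc: "S \<in> carrier_mat n n" and ZDc: "Z1 * D \<in> carrier_mat n n" by (rule carrier_matI; simp)+
  have F: "four_block_mat (X * D) S (Z1 * D) \<Delta> = ?U a * (?L b * (?U P' * ?L d))"
    unfolding four[symmetric] a_def b_def d_def \<Delta>'_def
    by (rule block_eq_four_unipotents[OF Sc ZDc Pc PP' Q(1) Q' \<Delta>_def])
  \<comment> \<open>\<open>V\<close> is the product of \<open>?U (Q * Y1)\<close>, the scaling of
    the first half by \<open>E\<close>, and \<open>?U (Zi * W1)\<close>: one upper layer, and the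
    only one of the six in which \<open>D\<close> may differ from the identity.\<close>
  define V where "V = four_block_mat E (E * (Zi * W1) + Q * Y1) (0\<^sub>m n n) (1\<^sub>m n)"
  have B_V: "B * ?U (Zi * W1) = four_block_mat (X * D) S (Z1 * D) \<Delta> * V"
    unfolding B_def V_def S_def \<Delta>_eq by (simp add: mat_dim_simps cs E) (auto simp: mat_dim_simps)
  have [simp]: "dim_row a = n" "dim_col a = n" "dim_row b = n" "dim_col b = n" "dim_row d = n"
    "dim_col d = n" "dim_row V = n + n" "dim_col V = n + n"
    by (simp_all add: a_def b_def d_def V_def)
  have "M = ?L (- p) * (?U a * (?L b * (?U P' * ?L d)) * V)" unfolding M_B B_V F ..
  also have "\<dots> = foldr (*) [?L (- p), ?U a, ?L b, ?U P', ?L d, V] (1\<^sub>m (2 * n))"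
    by (simp add: mat_assoc_dim mat_mult_one_dim mult_2)
  finally have M_eq: "M = foldr (*) [?L (- p), ?U a, ?L b, ?U P', ?L d, V] (1\<^sub>m (2 * n))" .
  have lay: "linear_affine_coupling_layer n (?L A)" "linear_affine_coupling_layer n (?U A)"
    if "dim_row A = n" "dim_col A = n" for A
    using that pos_diagonal_one[of n] unfolding linear_affine_coupling_layer_def by (blast intro: carrier_matI)+
  have "E * (Zi * W1) + Q * Y1 \<in> carrier_mat n n" by (rule carrier_matI) simp_all
  then have "linear_affine_coupling_layer n V"
    using E(1) unfolding linear_affine_coupling_layer_def V_def by blast
  then have "\<forall>L \<in> set [?L (- p), ?U a, ?L b, ?U P', ?L d, V]. linear_affine_coupling_layer n L"
    by (simp add: lay)
  moreover have "length [?L (- p), ?U a, ?L b, ?U P', ?L d, V] = 6" by simp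
  ultimately show ?thesis unfolding represented_by_depth_def using M_eq by blast
qed

theorem corollary0p3:
  shows "(\<forall>n\<ge>1. \<forall>M \<in> GL (2 * n). det M > 0 \<longrightarrow> represented_by_depth n 6 M) \<and>
         (\<forall>n>1. \<exists>M \<in> SL (2 * n). \<not> represented_by_depth n 5 M)"
  using six_layers_sufficient five_layers_insufficient by blast

end
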